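(* Let $G$ be a multiplier bicomonad on a monoidal category $\mathcal C$. Then the monoidal structure of $\mathcal C$ lifts to the category of $G$-comodules; that is, the category of $G$-comodules is monoidal in such a way that the forgetful functor to $\mathcal C$, $(V,\check v,\hat v)\mapsto V$, is strict monoidal.
   Context: Conventions: $\otimes$ is the monoidal product, $I$ the unit; composition is juxtaposition, $1$ denotes identities, associativity and unit isomorphisms are suppressed. A *multiplier bicomonad* on $\mathcal C$ is a functor $G:\mathcal C\to\mathcal C$ with natural transformations $\check G_2:GX\otimes GY\to G(GX\otimes Y)$, $\hat G_2:GX\otimes GY\to G(X\otimes GY)$ and $\varepsilon:GX\to X$ such that for all objects $X,Y,Z$: - (right multiplier bicomonad) $G(\check G_2\otimes 1)\check G_2(1\otimes\check G_2)=\check G_2(\check G_2\otimes 1):GX\otimes GY\otimes GZ\to G(G(GX\otimes Y)\otimes Z)$ and $\varepsilon\check G_2=1\otimes\varepsilon:GX\otimes GY\to GX\otimes Y$; - (left multiplier bicomonad) $G(1\otimes\hat G_2)\hat G_2(\hat G_2\otimes 1)=\hat G_2(1\otimes\hat G_2):GX\otimes GY\otimes GZ\to G(X\otimes G(Y\otimes GZ))$ and $\varepsilon\hat G_2=\varepsilon\otimes 1:GX\otimes GY\to X\otimes GY$; - $G(\varepsilon\otimes 1)\check G_2=G(1\otimes\varepsilon)\hat G_2:GX\otimes GY\to G(X\otimes Y)$; this common morphism is denoted $G_2$; - $G_2(1\otimes\check G_2)=G_2(\hat G_2\otimes 1):GX\otimes GY\otimes GZ\to G(X\otimes GY\otimes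 Z)$. A *comodule* over the multiplier bicomonad $G$ is an object $V$ with natural transformations $\check v:V\otimes G(-)\to G(V\otimes -)$ and $\hat v:G(-)\otimes V\to G(-\otimes V)$ such that for all objects $X,Y$: - $G(\check v\otimes 1)\check v(1\otimes\check G_2)=\check G_2(\check v\otimes 1):V\otimes GX\otimes GY\to G(G(V\otimes X)\otimes Y)$ and $\varepsilon\check v=1\otimes\varepsilon:V\otimes GX\to V\otimes X$; - $G(1\otimes\hat v)\hat v(\hat G_2\otimes 1)=\hat G_2(1\otimes\hat v):GX\otimes GY\otimes V\to G(X\otimes G(Y\otimes V))$ and $\varepsilon\hat v=\varepsilon\otimes 1:GX\otimes V\to X\otimes V$; - $G_2(1\otimes\check v)=G_2(\hat v\otimes 1):GX\otimes V\otimes GY\to G(X\otimes V\otimes Y)$. A *morphism* of comodules $(V,\check v,\hat v)\to(W,\check w,\hat w)$ is a morphism $f:V\to W$ in $\mathcal C$ such that $G(f\otimes 1)\check v=\check w(f\otimes 1):V\otimes GX\to G(W\otimes X)$ and $G(1\otimes f)\hat v=\hat w(1\otimes f):GX\otimes V\to G(X\otimes W)$ for all objects $X$. *)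

theory Defs
  imports "HOL-Library.FuncSet"
begin

section \<open>Categories, functors, natural transformations\<close>

text \<open>
  Composition is written in applicative order: \<open>g \<cdot> f\<close> is ``first \<open>f\<close>, then \<open>g\<close>''. Its value, like
  that of all other operations, is irrelevant outside the objects and composable arrows.
\<close>

record ('o, 'm) category =
  Obj :: "'o set"
  Arr :: "'m set"
  Dom :: "'m \<Rightarrow> 'o"
  Cod :: "'m \<Rightarrow> 'o"
  Idt :: "'o \<Rightarrow> 'm" ("\<one>\<index>")
  Comp :: "'m \<Rightarrow> 'm \<Rightarrow> 'm" (infixr "\<cdot>\<index>" 55)

definition Hom :: "('o, 'm, 'z) category_scheme \<Rightarrow> 'o \<Rightarrow> 'o \<Rightarrow> 'm set" where
  "Hom C X Y = {f \<in> Arr C. Dom C f = X \<and> Cod C f = Y}"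

locale category =
  fixes C (structure)
  assumes Dom_Obj: "f \<in> Arr C \<Longrightarrow> Dom C f \<in> Obj C"
    and Cod_Obj: "f \<in> Arr C \<Longrightarrow> Cod C f \<in> Obj C"
    and Idt_Hom: "X \<in> Obj C \<Longrightarrow> \<one> X \<in> Hom C X X"
    and Comp_Hom: "\<lbrakk>f \<in> Hom C X Y; g \<in> Hom C Y Z\<rbrakk> \<Longrightarrow> g \<cdot> f \<in> Hom C X Z"
    and Comp_Idt: "f \<in> Hom C X Y \<Longrightarrow> f \<cdot> \<one> X = f"
    and Idt_Comp: "f \<in> Hom C X Y \<Longrightarrow> \<one> Y \<cdot> f = f"
    and Comp_assoc: "\<lbrakk>f \<in> Hom C W X; g \<in> Hom C X Y; h \<in> Hom C Y Z\<rbrakk>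
      \<Longrightarrow> (h \<cdot> g) \<cdot> f = h \<cdot> (g \<cdot> f)"

definition is_inverse :: "('o, 'm, 'z) category_scheme \<Rightarrow> 'm \<Rightarrow> 'm \<Rightarrow> bool" where
  "is_inverse C f g \<longleftrightarrow> f \<in> Arr C \<and> g \<in> Hom C (Cod C f) (Dom C f)
     \<and> g \<cdot>\<^bsub>C\<^esub> f = \<one>\<^bsub>C\<^esub> (Dom C f) \<and> f \<cdot>\<^bsub>C\<^esub> g = \<one>\<^bsub>C\<^esub> (Cod C f)"

definition iso :: "('o, 'm, 'z) category_scheme \<Rightarrow> 'm \<Rightarrow> bool" where
  "iso C f \<longleftrightarrow> (\<exists>g. is_inverse C f g)"

definition inverse_of :: "('o, 'm, 'z) category_scheme \<Rightarrow> 'm \<Rightarrow> 'm" where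
  "inverse_of C f = (THE g. is_inverse C f g)"

definition prod_cat ::
  "('o1, 'm1, 'z1) category_scheme \<Rightarrow> ('o2, 'm2, 'z2) category_scheme
    \<Rightarrow> ('o1 \<times> 'o2, 'm1 \<times> 'm2) category" (infixr "\<times>\<^sub>C" 80) where
  "C \<times>\<^sub>C D = \<lparr>
     Obj = Obj C \<times> Obj D,
     Arr = Arr C \<times> Arr D,
     Dom = (\<lambda>(f, g). (Dom C f, Dom D g)),
     Cod = (\<lambda>(f, g). (Cod C f, Cod D g)),
     Idt = (\<lambda>(X, Y). (\<one>\<^bsub>C\<^esub> X, \<one>\<^bsub>D\<^esub> Y)),
     Comp = (\<lambda>(f', g') (f, g). (f' \<cdot>\<^bsub>C\<^esub> f, g' \<cdot>\<^bsub>D\<^esub> g)) \<rparr>"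

record ('o1, 'm1, 'o2, 'm2) func =
  OMap :: "'o1 \<Rightarrow> 'o2" (infixl "$\<^sub>o" 90)
  AMap :: "'m1 \<Rightarrow> 'm2" (infixl "$\<^sub>a" 90)

locale is_functor = A: category A + B: category B for A and B +
  fixes F
  assumes AMap_Hom: "f \<in> Hom A X Y \<Longrightarrow> F $\<^sub>a f \<in> Hom B (F $\<^sub>o X) (F $\<^sub>o Y)"
    and AMap_Idt: "X \<in> Obj A \<Longrightarrow> F $\<^sub>a (\<one>\<^bsub>A\<^esub> X) = \<one>\<^bsub>B\<^esub> (F $\<^sub>o X)"
    and AMap_Comp: "\<lbrakk>f \<in> Hom A X Y; g \<in> Hom A Y Z\<rbrakk>
      \<Longrightarrow> F $\<^sub>a (g \<cdot>\<^bsub>A\<^esub> f) = F $\<^sub>a g \<cdot>\<^bsub>B\<^esub> F $\<^sub>a f"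

locale nat_trans = F: is_functor A B F + H: is_functor A B H for A and B and F and H +
  fixes t
  assumes component_Hom: "X \<in> Obj A \<Longrightarrow> t X \<in> Hom B (F $\<^sub>o X) (H $\<^sub>o X)"
    and naturality: "f \<in> Hom A X Y \<Longrightarrow> H $\<^sub>a f \<cdot>\<^bsub>B\<^esub> t X = t Y \<cdot>\<^bsub>B\<^esub> F $\<^sub>a f"

abbreviation id_func :: "('o, 'm, 'o, 'm) func" where
  "id_func \<equiv> \<lparr>OMap = (\<lambda>X. X), AMap = (\<lambda>f. f)\<rparr>"


section \<open>Monoidal categories\<close>

text \<open>
  The tensor product is \<open>\<otimes>\<close> on objects and \<open>\<boxtimes>\<close> on arrows. The associator is
  \<open>\<alpha> X Y Z : (X \<otimes> Y) \<otimes> Z \<rightarrow> X \<otimes> (Y \<otimes> Z)\<close>, the unitors are \<open>I \<otimes> X \<rightarrow> X\<close> and \<open>X \<otimes> I \<rightarrow> X\<close>.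
\<close>

record ('o, 'm) monoidal_category = "('o, 'm) category" +
  TOb :: "'o \<Rightarrow> 'o \<Rightarrow> 'o" (infixr "\<otimes>\<index>" 70)
  TAr :: "'m \<Rightarrow> 'm \<Rightarrow> 'm" (infixr "\<boxtimes>\<index>" 70)
  Unit :: "'o"
  Assoc :: "'o \<Rightarrow> 'o \<Rightarrow> 'o \<Rightarrow> 'm" ("\<alpha>\<index>")
  LUnit :: "'o \<Rightarrow> 'm"
  RUnit :: "'o \<Rightarrow> 'm"

definition tensor :: "('o, 'm, 'z) monoidal_category_scheme \<Rightarrow> ('o \<times> 'o, 'm \<times> 'm, 'o, 'm) func" where
  "tensor C = \<lparr>OMap = (\<lambda>(X, Y). X \<otimes>\<^bsub>C\<^esub> Y), AMap = (\<lambda>(f, g). f \<boxtimes>\<^bsub>C\<^esub> g)\<rparr>"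

locale monoidal_category = category C for C (structure) +
  assumes tensor_functor: "is_functor (C \<times>\<^sub>C C) C (tensor C)"
    and Unit_Obj: "Unit C \<in> Obj C"
    and Assoc_nat: "nat_trans (C \<times>\<^sub>C C \<times>\<^sub>C C) C
      \<lparr>OMap = (\<lambda>(X, Y, Z). (X \<otimes> Y) \<otimes> Z), AMap = (\<lambda>(f, g, h). (f \<boxtimes> g) \<boxtimes> h)\<rparr>
      \<lparr>OMap = (\<lambda>(X, Y, Z). X \<otimes> (Y \<otimes> Z)), AMap = (\<lambda>(f, g, h). f \<boxtimes> (g \<boxtimes> h))\<rparr>
      (\<lambda>(X, Y, Z). \<alpha> X Y Z)"
    and Assoc_iso: "\<lbrakk>X \<in> Obj C; Y \<in> Obj C; Z \<in> Obj C\<rbrakk> \<Longrightarrow> iso C (\<alpha> X Y Z)"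
    and LUnit_nat: "nat_trans C C
      \<lparr>OMap = (\<lambda>X. Unit C \<otimes> X), AMap = (\<lambda>f. \<one> (Unit C) \<boxtimes> f)\<rparr> id_func (LUnit C)"
    and LUnit_iso: "X \<in> Obj C \<Longrightarrow> iso C (LUnit C X)"
    and RUnit_nat: "nat_trans C C
      \<lparr>OMap = (\<lambda>X. X \<otimes> Unit C), AMap = (\<lambda>f. f \<boxtimes> \<one> (Unit C))\<rparr> id_func (RUnit C)"
    and RUnit_iso: "X \<in> Obj C \<Longrightarrow> iso C (RUnit C X)"
    and pentagon: "\<lbrakk>W \<in> Obj C; X \<in> Obj C; Y \<in> Obj C; Z \<in> Obj C\<rbrakk> \<Longrightarrow>
      (\<one> W \<boxtimes> \<alpha> X Y Z) \<cdot> \<alpha> W (X \<otimes> Y) Z \<cdot> (\<alpha> W X Y \<boxtimes> \<one> Z)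
        = \<alpha> W X (Y \<otimes> Z) \<cdot> \<alpha> (W \<otimes> X) Y Z"
    and triangle: "\<lbrakk>X \<in> Obj C; Y \<in> Obj C\<rbrakk> \<Longrightarrow>
      (\<one> X \<boxtimes> LUnit C Y) \<cdot> \<alpha> X (Unit C) Y = RUnit C X \<boxtimes> \<one> Y"

locale strict_monoidal_functor =
  A: monoidal_category A + B: monoidal_category B + is_functor A B F for A and B and F +
  assumes OMap_tensor: "\<lbrakk>X \<in> Obj A; Y \<in> Obj A\<rbrakk> \<Longrightarrow> F $\<^sub>o (X \<otimes>\<^bsub>A\<^esub> Y) = F $\<^sub>o X \<otimes>\<^bsub>B\<^esub> F $\<^sub>o Y"
    and AMap_tensor: "\<lbrakk>f \<in> Arr A; g \<in> Arr A\<rbrakk> \<Longrightarrow> F $\<^sub>a (f \<boxtimes>\<^bsub>A\<^esub> g) = F $\<^sub>a f \<boxtimes>\<^bsub>B\<^esub> F $\<^sub>a g"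
    and OMap_Unit: "F $\<^sub>o (Unit A) = Unit B"
    and AMap_Assoc: "\<lbrakk>X \<in> Obj A; Y \<in> Obj A; Z \<in> Obj A\<rbrakk>
      \<Longrightarrow> F $\<^sub>a (\<alpha>\<^bsub>A\<^esub> X Y Z) = \<alpha>\<^bsub>B\<^esub> (F $\<^sub>o X) (F $\<^sub>o Y) (F $\<^sub>o Z)"
    and AMap_LUnit: "X \<in> Obj A \<Longrightarrow> F $\<^sub>a (LUnit A X) = LUnit B (F $\<^sub>o X)"
    and AMap_RUnit: "X \<in> Obj A \<Longrightarrow> F $\<^sub>a (RUnit A X) = RUnit B (F $\<^sub>o X)"


section \<open>Multiplier bicomonads\<close>

text \<open>
  \<open>Gcheck\<close> and \<open>Ghat\<close> are the two natural transformations usually written as $G_2$ with a check and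
  with a hat. Since the monoidal category need not be strict, the associators that are suppressed
  on paper are inserted in the axioms; the common domain of both sides is always bracketed to
  the left.
\<close>

record ('o, 'm) bicomonad = "('o, 'm, 'o, 'm) func" +
  Gcheck :: "'o \<Rightarrow> 'o \<Rightarrow> 'm"
  Ghat :: "'o \<Rightarrow> 'o \<Rightarrow> 'm"
  counit :: "'o \<Rightarrow> 'm"

definition G2 :: "('o, 'm, 'z) monoidal_category_scheme \<Rightarrow> ('o, 'm, 'y) bicomonad_scheme
    \<Rightarrow> 'o \<Rightarrow> 'o \<Rightarrow> 'm" where
  "G2 C G X Y = G $\<^sub>a (counit G X \<boxtimes>\<^bsub>C\<^esub> \<one>\<^bsub>C\<^esub> Y) \<cdot>\<^bsub>C\<^esub> Gcheck G X Y"

locale multiplier_bicomonad = monoidal_category C + is_functor C C G for C (structure) and G +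
  assumes Gcheck_nat: "nat_trans (C \<times>\<^sub>C C) C
      \<lparr>OMap = (\<lambda>(X, Y). G $\<^sub>o X \<otimes> G $\<^sub>o Y), AMap = (\<lambda>(f, g). G $\<^sub>a f \<boxtimes> G $\<^sub>a g)\<rparr>
      \<lparr>OMap = (\<lambda>(X, Y). G $\<^sub>o (G $\<^sub>o X \<otimes> Y)), AMap = (\<lambda>(f, g). G $\<^sub>a (G $\<^sub>a f \<boxtimes> g))\<rparr>
      (\<lambda>(X, Y). Gcheck G X Y)"
    and Ghat_nat: "nat_trans (C \<times>\<^sub>C C) C
      \<lparr>OMap = (\<lambda>(X, Y). G $\<^sub>o X \<otimes> G $\<^sub>o Y), AMap = (\<lambda>(f, g). G $\<^sub>a f \<boxtimes> G $\<^sub>a g)\<rparr>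
      \<lparr>OMap = (\<lambda>(X, Y). G $\<^sub>o (X \<otimes> G $\<^sub>o Y)), AMap = (\<lambda>(f, g). G $\<^sub>a (f \<boxtimes> G $\<^sub>a g))\<rparr>
      (\<lambda>(X, Y). Ghat G X Y)"
    and counit_nat: "nat_trans C C G id_func (counit G)"
    and Gcheck_Gcheck: "\<lbrakk>X \<in> Obj C; Y \<in> Obj C; Z \<in> Obj C\<rbrakk> \<Longrightarrow>
      G $\<^sub>a (Gcheck G X Y \<boxtimes> \<one> Z) \<cdot> G $\<^sub>a (inverse_of C (\<alpha> (G $\<^sub>o X) (G $\<^sub>o Y) Z))
          \<cdot> Gcheck G X (G $\<^sub>o Y \<otimes> Z) \<cdot> (\<one> (G $\<^sub>o X) \<boxtimes> Gcheck G Y Z)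
          \<cdot> \<alpha> (G $\<^sub>o X) (G $\<^sub>o Y) (G $\<^sub>o Z)
        = Gcheck G (G $\<^sub>o X \<otimes> Y) Z \<cdot> (Gcheck G X Y \<boxtimes> \<one> (G $\<^sub>o Z))"
    and counit_Gcheck: "\<lbrakk>X \<in> Obj C; Y \<in> Obj C\<rbrakk> \<Longrightarrow>
      counit G (G $\<^sub>o X \<otimes> Y) \<cdot> Gcheck G X Y = \<one> (G $\<^sub>o X) \<boxtimes> counit G Y"
    and Ghat_Ghat: "\<lbrakk>X \<in> Obj C; Y \<in> Obj C; Z \<in> Obj C\<rbrakk> \<Longrightarrow>
      G $\<^sub>a (\<one> X \<boxtimes> Ghat G Y Z) \<cdot> G $\<^sub>a (\<alpha> X (G $\<^sub>o Y) (G $\<^sub>o Z))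
          \<cdot> Ghat G (X \<otimes> G $\<^sub>o Y) Z \<cdot> (Ghat G X Y \<boxtimes> \<one> (G $\<^sub>o Z))
        = Ghat G X (Y \<otimes> G $\<^sub>o Z) \<cdot> (\<one> (G $\<^sub>o X) \<boxtimes> Ghat G Y Z)
          \<cdot> \<alpha> (G $\<^sub>o X) (G $\<^sub>o Y) (G $\<^sub>o Z)"
    and counit_Ghat: "\<lbrakk>X \<in> Obj C; Y \<in> Obj C\<rbrakk> \<Longrightarrow>
      counit G (X \<otimes> G $\<^sub>o Y) \<cdot> Ghat G X Y = counit G X \<boxtimes> \<one> (G $\<^sub>o Y)"
    and Gcheck_Ghat: "\<lbrakk>X \<in> Obj C; Y \<in> Obj C\<rbrakk> \<Longrightarrow>
      G $\<^sub>a (counit G X \<boxtimes> \<one> Y) \<cdot> Gcheck G X Y = G $\<^sub>a (\<one> X \<boxtimes> counit G Y) \<cdot> Ghat G X Y"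
    and G2_compat: "\<lbrakk>X \<in> Obj C; Y \<in> Obj C; Z \<in> Obj C\<rbrakk> \<Longrightarrow>
      G2 C G X (G $\<^sub>o Y \<otimes> Z) \<cdot> (\<one> (G $\<^sub>o X) \<boxtimes> Gcheck G Y Z) \<cdot> \<alpha> (G $\<^sub>o X) (G $\<^sub>o Y) (G $\<^sub>o Z)
        = G $\<^sub>a (\<alpha> X (G $\<^sub>o Y) Z) \<cdot> G2 C G (X \<otimes> G $\<^sub>o Y) Z \<cdot> (Ghat G X Y \<boxtimes> \<one> (G $\<^sub>o Z))"


section \<open>Comodules\<close>

record ('o, 'm) comodule =
  carr :: "'o"
  vcheck :: "'o \<Rightarrow> 'm"
  vhat :: "'o \<Rightarrow> 'm"

text \<open>
  The coactions are families indexed by the objects of \<open>C\<close>; they are required to be \<^const>\<open>extensional\<close>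
  so that equality of comodules does not depend on values at non-objects.
\<close>

locale comodule = multiplier_bicomonad C G for C (structure) and G +
  fixes V :: "('o, 'm) comodule"
  assumes carr_Obj: "carr V \<in> Obj C"
    and vcheck_ext: "vcheck V \<in> extensional (Obj C)"
    and vhat_ext: "vhat V \<in> extensional (Obj C)"
    and vcheck_nat: "nat_trans C C
      \<lparr>OMap = (\<lambda>X. carr V \<otimes> G $\<^sub>o X), AMap = (\<lambda>f. \<one> (carr V) \<boxtimes> G $\<^sub>a f)\<rparr>
      \<lparr>OMap = (\<lambda>X. G $\<^sub>o (carr V \<otimes> X)), AMap = (\<lambda>f. G $\<^sub>a (\<one> (carr V) \<boxtimes> f))\<rparr>
      (vcheck V)"
    and vhat_nat: "nat_trans C C
      \<lparr>OMap = (\<lambda>X. G $\<^sub>o X \<otimes> carr V), AMap = (\<lambda>f. G $\<^sub>a f \<boxtimes> \<one> (carr V))\<rparr>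
      \<lparr>OMap = (\<lambda>X. G $\<^sub>o (X \<otimes> carr V)), AMap = (\<lambda>f. G $\<^sub>a (f \<boxtimes> \<one> (carr V)))\<rparr>
      (vhat V)"
    and vcheck_Gcheck: "\<lbrakk>X \<in> Obj C; Y \<in> Obj C\<rbrakk> \<Longrightarrow>
      G $\<^sub>a (vcheck V X \<boxtimes> \<one> Y) \<cdot> G $\<^sub>a (inverse_of C (\<alpha> (carr V) (G $\<^sub>o X) Y))
          \<cdot> vcheck V (G $\<^sub>o X \<otimes> Y) \<cdot> (\<one> (carr V) \<boxtimes> Gcheck G X Y)
          \<cdot> \<alpha> (carr V) (G $\<^sub>o X) (G $\<^sub>o Y)
        = Gcheck G (carr V \<otimes> X) Y \<cdot> (vcheck V X \<boxtimes> \<one> (G $\<^sub>o Y))"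
    and counit_vcheck: "X \<in> Obj C \<Longrightarrow>
      counit G (carr V \<otimes> X) \<cdot> vcheck V X = \<one> (carr V) \<boxtimes> counit G X"
    and vhat_Ghat: "\<lbrakk>X \<in> Obj C; Y \<in> Obj C\<rbrakk> \<Longrightarrow>
      G $\<^sub>a (\<one> X \<boxtimes> vhat V Y) \<cdot> G $\<^sub>a (\<alpha> X (G $\<^sub>o Y) (carr V))
          \<cdot> vhat V (X \<otimes> G $\<^sub>o Y) \<cdot> (Ghat G X Y \<boxtimes> \<one> (carr V))
        = Ghat G X (Y \<otimes> carr V) \<cdot> (\<one> (G $\<^sub>o X) \<boxtimes> vhat V Y)
          \<cdot> \<alpha> (G $\<^sub>o X) (G $\<^sub>o Y) (carr V)"
    and counit_vhat: "X \<in> Obj C \<Longrightarrow>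
      counit G (X \<otimes> carr V) \<cdot> vhat V X = counit G X \<boxtimes> \<one> (carr V)"
    and vcheck_vhat: "\<lbrakk>X \<in> Obj C; Y \<in> Obj C\<rbrakk> \<Longrightarrow>
      G2 C G X (carr V \<otimes> Y) \<cdot> (\<one> (G $\<^sub>o X) \<boxtimes> vcheck V Y) \<cdot> \<alpha> (G $\<^sub>o X) (carr V) (G $\<^sub>o Y)
        = G $\<^sub>a (\<alpha> X (carr V) Y) \<cdot> G2 C G (X \<otimes> carr V) Y \<cdot> (vhat V X \<boxtimes> \<one> (G $\<^sub>o Y))"

locale comodule_morphism = V: comodule C G V + W: comodule C G W
  for C (structure) and G and V and W +
  fixes f
  assumes f_Hom: "f \<in> Hom C (carr V) (carr W)"
    and f_vcheck: "X \<in> Obj C \<Longrightarrow>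
      G $\<^sub>a (f \<boxtimes> \<one> X) \<cdot> vcheck V X = vcheck W X \<cdot> (f \<boxtimes> \<one> (G $\<^sub>o X))"
    and f_vhat: "X \<in> Obj C \<Longrightarrow>
      G $\<^sub>a (\<one> X \<boxtimes> f) \<cdot> vhat V X = vhat W X \<cdot> (\<one> (G $\<^sub>o X) \<boxtimes> f)"

text \<open>An arrow of the category of comodules is a morphism together with its domain and codomain.\<close>

definition comodule_cat ::
  "('o, 'm) monoidal_category \<Rightarrow> ('o, 'm) bicomonad
    \<Rightarrow> (('o, 'm) comodule, ('o, 'm) comodule \<times> 'm \<times> ('o, 'm) comodule) category" where
  "comodule_cat C G = \<lparr>
     Obj = {V. comodule C G V},
     Arr = {(V, f, W). comodule_morphism C G V W f},
     Dom = (\<lambda>(V, f, W). V),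
     Cod = (\<lambda>(V, f, W). W),
     Idt = (\<lambda>V. (V, \<one>\<^bsub>C\<^esub> (carr V), V)),
     Comp = (\<lambda>(V', g, W) (U, f, V). (U, g \<cdot>\<^bsub>C\<^esub> f, W)) \<rparr>"

definition forgetful ::
  "(('o, 'm) comodule, ('o, 'm) comodule \<times> 'm \<times> ('o, 'm) comodule, 'o, 'm) func" where
  "forgetful = \<lparr>OMap = carr, AMap = (\<lambda>(V, f, W). f)\<rparr>"

end

theory Submission
  imports Defs
begin

text \<open>
  A comodule structure on \<open>V\<close> is a pair of coactions, one moving \<open>V\<close> into \<open>G\<close> from the left,
  \<open>v : V \<otimes> G - \<rightarrow> G (V \<otimes> -)\<close>, and one moving it into \<open>G\<close> from the right. Such transformations
  compose: to move \<open>V \<otimes> W\<close> into \<open>G\<close>, move first \<open>W\<close> and then \<open>V\<close>,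
  \<open>V \<otimes> W \<otimes> G X \<rightarrow> V \<otimes> G (W \<otimes> X) \<rightarrow> G (V \<otimes> W \<otimes> X)\<close>, and the unit object is moved by the unit isomorphisms. Put differently, \<open>v\<close> is a natural
  transformation \<open>L\<^sub>V G \<rightarrow> G L\<^sub>V\<close> for the functor \<open>L\<^sub>V = V \<otimes> -\<close>; these paste strictly associatively,
  and the coaction on \<open>V \<otimes> W\<close> is the pasted one, transported along \<open>L\<^sub>V L\<^sub>W \<cong> L\<^bsub>V \<otimes> W\<^esub>\<close>.
  Therefore the axioms for the coaction on \<open>V \<otimes> W\<close> follow from those for \<open>v\<close> and \<open>w\<close> and naturality
  (\<open>right_coaction_tensor\<close>, \<open>right_coaction_unit\<close>), and the associativity and unit isomorphisms of the base
  category commute with the coactions because they satisfy the pentagon and triangle identities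
  (\<open>coaction_hom_Assoc\<close>, \<open>coaction_hom_LUnit\<close>, \<open>coaction_hom_RUnit\<close>).

  All this concerns one of the two coactions. The other one is a coaction of the same kind
  in the reversed monoidal category, where \<open>X \<otimes> Y\<close> is replaced by \<open>Y \<otimes> X\<close>, so that everything
  proved about the first applies to it (\<open>monoidal_category_rev_monoidal\<close>,
  \<open>right_multiplication_Ghat\<close>). The only axiom of a comodule that involves both coactions is the
  compatibility with \<open>G2\<close>; for \<open>V \<otimes> W\<close> it follows by moving first \<open>V\<close> and then \<open>W\<close> from
  one side of \<open>G2\<close> to the other (\<open>compatible_tensor\<close>).

  The comodule isomorphisms found in this way are given by the associator and unitors of the
  base category, and the forgetful functor is faithful; hence the naturality and coherence
  laws hold for comodules because they hold in the base category.
\<close>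

section \<open>Categories and functors\<close>

context category
begin

lemma Idt_simps [simp]:
  assumes "X \<in> Obj C"
  shows "\<one> X \<in> Arr C" "Dom C (\<one> X) = X" "Cod C (\<one> X) = X"
  using Idt_Hom[OF assms] by (auto simp: Hom_def)

lemma Comp_simps [simp]:
  assumes "f \<in> Arr C" "g \<in> Arr C" "Dom C g = Cod C f"
  shows "g \<cdot> f \<in> Arr C" "Dom C (g \<cdot> f) = Dom C f" "Cod C (g \<cdot> f) = Cod C g"
  using Comp_Hom[of f "Dom C f" "Cod C f" g "Cod C g"] assms by (auto simp: Hom_def)

lemma Dom_Cod_Obj [simp]:
  "f \<in> Arr C \<Longrightarrow> Dom C f \<in> Obj C" "f \<in> Arr C \<Longrightarrow> Cod C f \<in> Obj C"
  by (auto intro: Dom_Obj Cod_Obj)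

lemma unit_laws [simp]:
  "\<lbrakk>f \<in> Arr C; Dom C f = X\<rbrakk> \<Longrightarrow> f \<cdot> \<one> X = f"
  "\<lbrakk>f \<in> Arr C; Cod C f = X\<rbrakk> \<Longrightarrow> \<one> X \<cdot> f = f"
  using Comp_Idt Idt_Comp by (auto simp: Hom_def)

lemma assoc_law [simp]:
  "\<lbrakk>f \<in> Arr C; g \<in> Arr C; h \<in> Arr C; Dom C g = Cod C f; Dom C h = Cod C g\<rbrakk>
    \<Longrightarrow> (h \<cdot> g) \<cdot> f = h \<cdot> g \<cdot> f"
  using Comp_assoc by (auto simp: Hom_def)

text \<open>
  Composites are kept bracketed to the right. To rewrite with an equation between composites
  in the middle of a longer one, the equation is precomposed with an arbitrary arrow.
\<close>

lemma reassoc2: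
  assumes "a \<cdot> b = r" "a \<in> Arr C" "b \<in> Arr C" "Dom C a = Cod C b"
    "k \<in> Arr C" "Cod C k = Dom C b"
  shows "a \<cdot> b \<cdot> k = r \<cdot> k"
  using assms by (metis assoc_law)

lemma reassoc3:
  assumes "a \<cdot> b \<cdot> c = r" "a \<in> Arr C" "b \<in> Arr C" "c \<in> Arr C"
    "Dom C a = Cod C b" "Dom C b = Cod C c" "k \<in> Arr C" "Cod C k = Dom C c"
  shows "a \<cdot> b \<cdot> c \<cdot> k = r \<cdot> k"
  using assms(2-) by (simp flip: assms(1))

lemma reassoc4:
  assumes "a \<cdot> b \<cdot> c \<cdot> d = r" "a \<in> Arr C" "b \<in> Arr C" "c \<in> Arr C" "d \<in> Arr C"
    "Dom C a = Cod C b" "Dom C b = Cod C c" "Dom C c = Cod C d" "k \<in> Arr C" "Cod C k = Dom C d"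
  shows "a \<cdot> b \<cdot> c \<cdot> d \<cdot> k = r \<cdot> k"
  using assms(2-) by (simp flip: assms(1))

lemma is_inverse_iff:
  "is_inverse C f g \<longleftrightarrow> f \<in> Arr C \<and> g \<in> Arr C \<and> Dom C g = Cod C f \<and> Cod C g = Dom C f
     \<and> g \<cdot> f = \<one> (Dom C f) \<and> f \<cdot> g = \<one> (Cod C f)"
  by (auto simp: is_inverse_def Hom_def)

lemma inverse_unique:
  assumes "is_inverse C f g" "is_inverse C f h"
  shows "g = h"
proof -
  have "g = g \<cdot> f \<cdot> h" using assms by (simp add: is_inverse_iff)
  also have "\<dots> = (g \<cdot> f) \<cdot> h"
    by (rule assoc_law[symmetric]) (use assms in \<open>auto simp: is_inverse_iff\<close>)
  also have "\<dots> = h" using assms by (simp add: is_inverse_iff del: assoc_law)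
  finally show ?thesis .
qed

lemma inverse_of_eq: "is_inverse C f g \<Longrightarrow> inverse_of C f = g"
  unfolding inverse_of_def using inverse_unique by blast

lemma is_inverse_inverse_of: "iso C f \<Longrightarrow> is_inverse C f (inverse_of C f)"
  using inverse_of_eq by (auto simp: iso_def)

lemma iso_simps [simp]:
  assumes "iso C f"
  shows "f \<in> Arr C" "inverse_of C f \<in> Arr C"
    "Dom C (inverse_of C f) = Cod C f" "Cod C (inverse_of C f) = Dom C f"
    "inverse_of C f \<cdot> f = \<one> (Dom C f)" "f \<cdot> inverse_of C f = \<one> (Cod C f)"
  using is_inverse_inverse_of[OF assms] by (auto simp: is_inverse_iff)

lemma inverse_cancel [simp]:
  assumes "is_inverse C f g"
  shows "g \<cdot> f = \<one> (Dom C f)" "f \<cdot> g = \<one> (Cod C f)"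
    "\<lbrakk>k \<in> Arr C; Cod C k = Dom C f\<rbrakk> \<Longrightarrow> g \<cdot> f \<cdot> k = k"
    "\<lbrakk>k \<in> Arr C; Cod C k = Cod C f\<rbrakk> \<Longrightarrow> f \<cdot> g \<cdot> k = k"
  using assms reassoc2[of g f "\<one> (Dom C f)" k] reassoc2[of f g "\<one> (Cod C f)" k]
  by (auto simp: is_inverse_iff)

lemma is_inverse_inverse_of' [simp]:
  assumes "iso C f"
  shows "is_inverse C f (inverse_of C f)" "is_inverse C (inverse_of C f) f"
  using assms by (simp_all add: is_inverse_iff del: inverse_cancel)

lemma iso_inverse_of [simp]: "iso C f \<Longrightarrow> iso C (inverse_of C f)"
  and inverse_of_inverse_of [simp]: "iso C f \<Longrightarrow> inverse_of C (inverse_of C f) = f"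
proof -
  assume "iso C f"
  then have "is_inverse C (inverse_of C f) f"
    by simp
  then show "iso C (inverse_of C f)" "inverse_of C (inverse_of C f) = f"
    using inverse_of_eq by (auto simp: iso_def)
qed

lemma iso_left_cancel:
  assumes "iso C f" "f \<cdot> a = f \<cdot> b" "a \<in> Arr C" "b \<in> Arr C" "Cod C a = Dom C f" "Cod C b = Dom C f"
  shows "a = b"
  using assms by (metis inverse_cancel(3) is_inverse_inverse_of)

lemma iso_right_cancel:
  assumes "iso C f" "a \<cdot> f = b \<cdot> f" "a \<in> Arr C" "b \<in> Arr C" "Dom C a = Cod C f" "Dom C b = Cod C f"
  shows "a = b"
proof -
  have "(a \<cdot> f) \<cdot> inverse_of C f = (b \<cdot> f) \<cdot> inverse_of C f" using assms(2) by simp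
  then show ?thesis using assms(1,3-) by simp
qed

end

context is_functor
begin

lemma AMap_simps [simp]:
  assumes "f \<in> Arr A"
  shows "F $\<^sub>a f \<in> Arr B" "Dom B (F $\<^sub>a f) = F $\<^sub>o (Dom A f)" "Cod B (F $\<^sub>a f) = F $\<^sub>o (Cod A f)"
  using AMap_Hom[of f "Dom A f" "Cod A f"] assms by (auto simp: Hom_def)

lemma OMap_Obj [simp]: "X \<in> Obj A \<Longrightarrow> F $\<^sub>o X \<in> Obj B"
  using B.Dom_Cod_Obj(1)[of "F $\<^sub>a \<one>\<^bsub>A\<^esub> X"] by simp

lemma AMap_unit [simp]: "X \<in> Obj A \<Longrightarrow> F $\<^sub>a (\<one>\<^bsub>A\<^esub> X) = \<one>\<^bsub>B\<^esub> (F $\<^sub>o X)"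
  by (rule AMap_Idt)

lemma AMap_comp [simp]:
  "\<lbrakk>f \<in> Arr A; g \<in> Arr A; Dom A g = Cod A f\<rbrakk> \<Longrightarrow> F $\<^sub>a (g \<cdot>\<^bsub>A\<^esub> f) = F $\<^sub>a g \<cdot>\<^bsub>B\<^esub> F $\<^sub>a f"
  using AMap_Comp by (auto simp: Hom_def)

lemma is_inverse_AMap [simp]:
  assumes "is_inverse A f g"
  shows "is_inverse B (F $\<^sub>a f) (F $\<^sub>a g)"
  using assms AMap_comp[of f g] AMap_comp[of g f]
  by (simp add: A.is_inverse_iff B.is_inverse_iff del: A.inverse_cancel B.inverse_cancel)

lemma iso_AMap [simp]: "iso A f \<Longrightarrow> iso B (F $\<^sub>a f)"
  by (meson iso_def is_inverse_AMap)

end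

lemma is_functorI:
  assumes "category A" "category B"
    and "\<And>f. f \<in> Arr A \<Longrightarrow> F $\<^sub>a f \<in> Hom B (F $\<^sub>o (Dom A f)) (F $\<^sub>o (Cod A f))"
    and "\<And>X. X \<in> Obj A \<Longrightarrow> F $\<^sub>a (\<one>\<^bsub>A\<^esub> X) = \<one>\<^bsub>B\<^esub> (F $\<^sub>o X)"
    and "\<And>f g. \<lbrakk>f \<in> Arr A; g \<in> Arr A; Dom A g = Cod A f\<rbrakk> \<Longrightarrow> F $\<^sub>a (g \<cdot>\<^bsub>A\<^esub> f) = F $\<^sub>a g \<cdot>\<^bsub>B\<^esub> F $\<^sub>a f"
  shows "is_functor A B F"
  using assms unfolding is_functor_def is_functor_axioms_def by (auto simp: Hom_def)

lemma nat_trans_iff: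
  assumes "is_functor A B F" "is_functor A B H"
  shows "nat_trans A B F H t \<longleftrightarrow>
    (\<forall>X \<in> Obj A. t X \<in> Hom B (F $\<^sub>o X) (H $\<^sub>o X)) \<and>
    (\<forall>f \<in> Arr A. H $\<^sub>a f \<cdot>\<^bsub>B\<^esub> t (Dom A f) = t (Cod A f) \<cdot>\<^bsub>B\<^esub> F $\<^sub>a f)"
  using assms unfolding nat_trans_def nat_trans_axioms_def by (auto simp: Hom_def)

lemma prod_cat_simps [simp]:
  "Obj (A \<times>\<^sub>C B) = Obj A \<times> Obj B" "Arr (A \<times>\<^sub>C B) = Arr A \<times> Arr B"
  "Dom (A \<times>\<^sub>C B) (f, g) = (Dom A f, Dom B g)" "Cod (A \<times>\<^sub>C B) (f, g) = (Cod A f, Cod B g)"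
  "Idt (A \<times>\<^sub>C B) (X, Y) = (\<one>\<^bsub>A\<^esub> X, \<one>\<^bsub>B\<^esub> Y)"
  "(f', g') \<cdot>\<^bsub>A \<times>\<^sub>C B\<^esub> (f, g) = (f' \<cdot>\<^bsub>A\<^esub> f, g' \<cdot>\<^bsub>B\<^esub> g)"
  by (auto simp: prod_cat_def)

lemma category_prod_cat:
  assumes "category A" "category B"
  shows "category (A \<times>\<^sub>C B)"
proof -
  interpret A: category A by fact
  interpret B: category B by fact
  show ?thesis
    by unfold_locales (auto simp: Hom_def)
qed

section \<open>Monoidal categories\<close>

context monoidal_category
begin

lemma tensor_simps [simp]:
  assumes "f \<in> Arr C" "g \<in> Arr C"
  shows "f \<boxtimes> g \<in> Arr C" "Dom C (f \<boxtimes> g) = Dom C f \<otimes> Dom C g" "Cod C (f \<boxtimes> g) = Cod C f \<otimes> Cod C g"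
  using is_functor.AMap_simps[OF tensor_functor, of "(f, g)"] assms by (auto simp: tensor_def)

lemma tensor_Obj [simp]: "\<lbrakk>X \<in> Obj C; Y \<in> Obj C\<rbrakk> \<Longrightarrow> X \<otimes> Y \<in> Obj C"
  using is_functor.OMap_Obj[OF tensor_functor, of "(X, Y)"] by (auto simp: tensor_def)

lemma tensor_Idt [simp]: "\<lbrakk>X \<in> Obj C; Y \<in> Obj C\<rbrakk> \<Longrightarrow> \<one> X \<boxtimes> \<one> Y = \<one> (X \<otimes> Y)"
  using is_functor.AMap_unit[OF tensor_functor, of "(X, Y)"] by (auto simp: tensor_def)

lemma interchange:
  assumes "f \<in> Arr C" "g \<in> Arr C" "f' \<in> Arr C" "g' \<in> Arr C" "Dom C f' = Cod C f" "Dom C g' = Cod C g"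
  shows "(f' \<boxtimes> g') \<cdot> (f \<boxtimes> g) = (f' \<cdot> f) \<boxtimes> (g' \<cdot> g)"
  using is_functor.AMap_comp[OF tensor_functor, of "(f, g)" "(f', g')"] assms
  by (simp add: tensor_def)

text \<open>
  Oriented this way, simplification splits every tensor product with an identity, so that a
  composite becomes a chain of single natural transformations to which the next axiom or
  naturality square applies.
\<close>

lemma whisker_comp [simp]:
  assumes "f \<in> Arr C" "g \<in> Arr C" "Dom C g = Cod C f" "X \<in> Obj C"
  shows "(g \<cdot> f) \<boxtimes> \<one> X = (g \<boxtimes> \<one> X) \<cdot> (f \<boxtimes> \<one> X)" "\<one> X \<boxtimes> (g \<cdot> f) = (\<one> X \<boxtimes> g) \<cdot> (\<one> X \<boxtimes> f)"
  using assms by (simp_all add: interchange)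

lemma is_inverse_whisker [simp]:
  assumes "is_inverse C f g" "X \<in> Obj C"
  shows "is_inverse C (f \<boxtimes> \<one> X) (g \<boxtimes> \<one> X)" "is_inverse C (\<one> X \<boxtimes> f) (\<one> X \<boxtimes> g)"
  using assms by (simp_all add: is_inverse_iff interchange del: inverse_cancel)

lemma iso_whisker [simp]:
  "\<lbrakk>iso C f; X \<in> Obj C\<rbrakk> \<Longrightarrow> iso C (f \<boxtimes> \<one> X)"
  "\<lbrakk>iso C f; X \<in> Obj C\<rbrakk> \<Longrightarrow> iso C (\<one> X \<boxtimes> f)"
  by (meson iso_def is_inverse_whisker)+

lemma Unit_in_Obj [simp]: "Unit C \<in> Obj C"
  by (rule Unit_Obj)

abbreviation assoc_inv ("\<a>") where "\<a> X Y Z \<equiv> inverse_of C (\<alpha> X Y Z)"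

lemma Assoc_simps [simp]:
  assumes "X \<in> Obj C" "Y \<in> Obj C" "Z \<in> Obj C"
  shows "iso C (\<alpha> X Y Z)" "\<alpha> X Y Z \<in> Arr C"
    "Dom C (\<alpha> X Y Z) = (X \<otimes> Y) \<otimes> Z" "Cod C (\<alpha> X Y Z) = X \<otimes> Y \<otimes> Z"
  using nat_trans.component_Hom[OF Assoc_nat, of "(X, Y, Z)"] assms
  by (auto simp: Hom_def intro: Assoc_iso)

lemma Assoc_natural:
  assumes "f \<in> Arr C" "g \<in> Arr C" "h \<in> Arr C" "Cod C f = X" "Cod C g = Y" "Cod C h = Z"
  shows "\<alpha> X Y Z \<cdot> ((f \<boxtimes> g) \<boxtimes> h) = (f \<boxtimes> g \<boxtimes> h) \<cdot> \<alpha> (Dom C f) (Dom C g) (Dom C h)"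
  using nat_trans.naturality[OF Assoc_nat, of "(f, g, h)" "(Dom C f, Dom C g, Dom C h)" "(X, Y, Z)"]
    assms by (simp add: Hom_def)

lemma Assoc_natural3:
  assumes "h \<in> Arr C" "X \<in> Obj C" "Y \<in> Obj C" "Cod C h = Z"
  shows "\<alpha> X Y Z \<cdot> (\<one> (X \<otimes> Y) \<boxtimes> h) = (\<one> X \<boxtimes> \<one> Y \<boxtimes> h) \<cdot> \<alpha> X Y (Dom C h)"
  using Assoc_natural[of "\<one> X" "\<one> Y" h X Y Z] assms by simp

lemma Assoc_inv_natural:
  assumes "f \<in> Arr C" "g \<in> Arr C" "h \<in> Arr C" "Cod C f = X" "Cod C g = Y" "Cod C h = Z"
  shows "\<a> X Y Z \<cdot> (f \<boxtimes> g \<boxtimes> h) = ((f \<boxtimes> g) \<boxtimes> h) \<cdot> \<a> (Dom C f) (Dom C g) (Dom C h)"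
proof (rule iso_left_cancel[of "\<alpha> X Y Z"])
  show "\<alpha> X Y Z \<cdot> \<a> X Y Z \<cdot> (f \<boxtimes> g \<boxtimes> h)
      = \<alpha> X Y Z \<cdot> ((f \<boxtimes> g) \<boxtimes> h) \<cdot> \<a> (Dom C f) (Dom C g) (Dom C h)"
    using assms by (auto simp: reassoc2[OF Assoc_natural])
qed (use assms in auto)

lemma Assoc_inv_natural1:
  assumes "f \<in> Arr C" "Y \<in> Obj C" "Z \<in> Obj C" "Cod C f = X"
  shows "\<a> X Y Z \<cdot> (f \<boxtimes> \<one> (Y \<otimes> Z)) = ((f \<boxtimes> \<one> Y) \<boxtimes> \<one> Z) \<cdot> \<a> (Dom C f) Y Z"
  using Assoc_inv_natural[of f "\<one> Y" "\<one> Z" X Y Z] assms by simp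

lemma pentagon_inv:
  assumes "W \<in> Obj C" "X \<in> Obj C" "Y \<in> Obj C" "Z \<in> Obj C"
  shows "(\<a> W X Y \<boxtimes> \<one> Z) \<cdot> \<a> W (X \<otimes> Y) Z \<cdot> (\<one> W \<boxtimes> \<a> X Y Z) = \<a> (W \<otimes> X) Y Z \<cdot> \<a> W X (Y \<otimes> Z)"
proof (rule iso_left_cancel[of "\<alpha> (W \<otimes> X) Y Z"])
  show "\<alpha> (W \<otimes> X) Y Z \<cdot> (\<a> W X Y \<boxtimes> \<one> Z) \<cdot> \<a> W (X \<otimes> Y) Z \<cdot> (\<one> W \<boxtimes> \<a> X Y Z)
      = \<alpha> (W \<otimes> X) Y Z \<cdot> \<a> (W \<otimes> X) Y Z \<cdot> \<a> W X (Y \<otimes> Z)"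
  proof (rule iso_left_cancel[of "\<alpha> W X (Y \<otimes> Z)"])
    show "\<alpha> W X (Y \<otimes> Z) \<cdot> \<alpha> (W \<otimes> X) Y Z \<cdot> (\<a> W X Y \<boxtimes> \<one> Z) \<cdot> \<a> W (X \<otimes> Y) Z \<cdot> (\<one> W \<boxtimes> \<a> X Y Z)
        = \<alpha> W X (Y \<otimes> Z) \<cdot> \<alpha> (W \<otimes> X) Y Z \<cdot> \<a> (W \<otimes> X) Y Z \<cdot> \<a> W X (Y \<otimes> Z)"
      using assms by (simp add: reassoc2[OF pentagon[symmetric]])
  qed (use assms in auto)
qed (use assms in auto)

text \<open>
  The pentagon with some of its sides inverted. The first form rebrackets, under \<open>G\<close>, the codomain of a
  coaction on a tensor product, the second one its domain.
\<close>

lemma pentagon_mixed: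
  assumes "W \<in> Obj C" "X \<in> Obj C" "Y \<in> Obj C" "Z \<in> Obj C"
  shows "(\<alpha> W X Y \<boxtimes> \<one> Z) \<cdot> \<a> (W \<otimes> X) Y Z \<cdot> \<a> W X (Y \<otimes> Z) = \<a> W (X \<otimes> Y) Z \<cdot> (\<one> W \<boxtimes> \<a> X Y Z)"
    and "\<a> W (X \<otimes> Y) Z \<cdot> (\<one> W \<boxtimes> \<a> X Y Z) \<cdot> \<alpha> W X (Y \<otimes> Z) = (\<alpha> W X Y \<boxtimes> \<one> Z) \<cdot> \<a> (W \<otimes> X) Y Z"
proof -
  show *: "(\<alpha> W X Y \<boxtimes> \<one> Z) \<cdot> \<a> (W \<otimes> X) Y Z \<cdot> \<a> W X (Y \<otimes> Z) = \<a> W (X \<otimes> Y) Z \<cdot> (\<one> W \<boxtimes> \<a> X Y Z)"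
    using assms by (simp flip: pentagon_inv)
  show "\<a> W (X \<otimes> Y) Z \<cdot> (\<one> W \<boxtimes> \<a> X Y Z) \<cdot> \<alpha> W X (Y \<otimes> Z) = (\<alpha> W X Y \<boxtimes> \<one> Z) \<cdot> \<a> (W \<otimes> X) Y Z"
    using assms by (simp add: reassoc2[OF *[symmetric]])
qed

lemma LUnit_simps [simp]:
  assumes "X \<in> Obj C"
  shows "iso C (LUnit C X)" "LUnit C X \<in> Arr C" "Dom C (LUnit C X) = Unit C \<otimes> X" "Cod C (LUnit C X) = X"
  using nat_trans.component_Hom[OF LUnit_nat assms] assms by (auto simp: Hom_def intro: LUnit_iso)

lemma RUnit_simps [simp]:
  assumes "X \<in> Obj C"
  shows "iso C (RUnit C X)" "RUnit C X \<in> Arr C" "Dom C (RUnit C X) = X \<otimes> Unit C" "Cod C (RUnit C X) = X"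
  using nat_trans.component_Hom[OF RUnit_nat assms] assms by (auto simp: Hom_def intro: RUnit_iso)

lemma LUnit_natural:
  "\<lbrakk>f \<in> Arr C; Cod C f = Y\<rbrakk> \<Longrightarrow> LUnit C Y \<cdot> (\<one> (Unit C) \<boxtimes> f) = f \<cdot> LUnit C (Dom C f)"
  using nat_trans.naturality[OF LUnit_nat, of f "Dom C f" Y] by (simp add: Hom_def)

lemma RUnit_natural:
  "\<lbrakk>f \<in> Arr C; Cod C f = Y\<rbrakk> \<Longrightarrow> RUnit C Y \<cdot> (f \<boxtimes> \<one> (Unit C)) = f \<cdot> RUnit C (Dom C f)"
  using nat_trans.naturality[OF RUnit_nat, of f "Dom C f" Y] by (simp add: Hom_def)

text \<open>
  By naturality of the left unitor, \<open>I \<otimes> -\<close> is isomorphic to the identity functor.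
\<close>

lemma Unit_tensor_faithful:
  assumes "\<one> (Unit C) \<boxtimes> f = \<one> (Unit C) \<boxtimes> g" "f \<in> Arr C" "g \<in> Arr C" "Dom C f = Dom C g" "Cod C f = Cod C g"
  shows "f = g"
proof (rule iso_right_cancel[of "LUnit C (Dom C f)"])
  show "f \<cdot> LUnit C (Dom C f) = g \<cdot> LUnit C (Dom C f)"
    using assms LUnit_natural[of f] LUnit_natural[of g] by simp
qed (use assms in auto)

text \<open>
  Kelly's derivation of the second triangle identity: by faithfulness of \<open>I \<otimes> -\<close> it suffices to
  prove it after tensoring with \<open>I\<close>, where it is a face of the pentagon on \<open>I, I, X, Y\<close> whose other
  faces are naturality squares and instances of the first triangle identity.
\<close>

lemma LUnit_tensor:
  assumes "X \<in> Obj C" "Y \<in> Obj C"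
  shows "LUnit C (X \<otimes> Y) \<cdot> \<alpha> (Unit C) X Y = LUnit C X \<boxtimes> \<one> Y"
proof (rule Unit_tensor_faithful)
  let ?I = "Unit C"
  show "\<one> ?I \<boxtimes> (LUnit C (X \<otimes> Y) \<cdot> \<alpha> ?I X Y) = \<one> ?I \<boxtimes> (LUnit C X \<boxtimes> \<one> Y)"
  proof (rule iso_right_cancel[of "\<alpha> ?I (?I \<otimes> X) Y"], goal_cases)
    case 2
    show ?case
    proof (rule iso_right_cancel[of "\<alpha> ?I ?I X \<boxtimes> \<one> Y"], goal_cases)
      case 2
      have "((\<one> ?I \<boxtimes> (LUnit C (X \<otimes> Y) \<cdot> \<alpha> ?I X Y)) \<cdot> \<alpha> ?I (?I \<otimes> X) Y) \<cdot> (\<alpha> ?I ?I X \<boxtimes> \<one> Y)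
        = (\<one> ?I \<boxtimes> LUnit C (X \<otimes> Y)) \<cdot> \<alpha> ?I ?I (X \<otimes> Y) \<cdot> \<alpha> (?I \<otimes> ?I) X Y"
        using assms by (simp add: pentagon)
      also have "\<dots> = (RUnit C ?I \<boxtimes> \<one> (X \<otimes> Y)) \<cdot> \<alpha> (?I \<otimes> ?I) X Y"
        using assms by (simp add: reassoc2[OF triangle])
      also have "\<dots> = \<alpha> ?I X Y \<cdot> ((RUnit C ?I \<boxtimes> \<one> X) \<boxtimes> \<one> Y)"
        using assms by (simp add: Assoc_natural)
      also have "\<dots> = \<alpha> ?I X Y \<cdot> ((\<one> ?I \<boxtimes> LUnit C X) \<boxtimes> \<one> Y) \<cdot> (\<alpha> ?I ?I X \<boxtimes> \<one> Y)"
        using assms by (simp flip: triangle)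
      also have "\<dots> = ((\<one> ?I \<boxtimes> LUnit C X \<boxtimes> \<one> Y) \<cdot> \<alpha> ?I (?I \<otimes> X) Y) \<cdot> (\<alpha> ?I ?I X \<boxtimes> \<one> Y)"
        using assms by (simp add: reassoc2[OF Assoc_natural])
      finally show ?case .
    qed (use assms in auto)
  qed (use assms in auto)
qed (use assms in auto)

lemma LUnit_inv_natural:
  assumes "f \<in> Arr C" "Dom C f = X"
  shows "(\<one> (Unit C) \<boxtimes> f) \<cdot> inverse_of C (LUnit C X) = inverse_of C (LUnit C (Cod C f)) \<cdot> f"
proof (rule iso_left_cancel[of "LUnit C (Cod C f)"])
  show "LUnit C (Cod C f) \<cdot> (\<one> (Unit C) \<boxtimes> f) \<cdot> inverse_of C (LUnit C X)
      = LUnit C (Cod C f) \<cdot> inverse_of C (LUnit C (Cod C f)) \<cdot> f"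
    using assms by (auto simp: reassoc2[OF LUnit_natural])
qed (use assms in auto)

lemma LUnit_tensor_inv:
  assumes "X \<in> Obj C" "Y \<in> Obj C"
  shows "(LUnit C X \<boxtimes> \<one> Y) \<cdot> \<a> (Unit C) X Y = LUnit C (X \<otimes> Y)"
  using assms by (simp flip: LUnit_tensor)

lemma triangle_inv:
  assumes "X \<in> Obj C" "Y \<in> Obj C"
  shows "(RUnit C X \<boxtimes> \<one> Y) \<cdot> \<a> X (Unit C) Y = \<one> X \<boxtimes> LUnit C Y"
  using assms by (simp flip: triangle)

lemma tensor_split:
  assumes "f \<in> Arr C" "g \<in> Arr C" "Dom C f = X" "Cod C g = Y"
  shows "f \<boxtimes> g = (f \<boxtimes> \<one> Y) \<cdot> (\<one> X \<boxtimes> g)"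
  using assms by (auto simp: interchange)

end

text \<open>
  The defining data of a monoidal category, stated elementwise instead of by functors on product
  categories; both the reversed category and the category of comodules are recognised by it.
\<close>

lemma monoidal_categoryI:
  fixes C (structure)
  assumes "category C"
    and tensor: "\<And>f g. \<lbrakk>f \<in> Arr C; g \<in> Arr C\<rbrakk>
      \<Longrightarrow> f \<boxtimes> g \<in> Hom C (Dom C f \<otimes> Dom C g) (Cod C f \<otimes> Cod C g)"
    and tensor_Idt: "\<And>X Y. \<lbrakk>X \<in> Obj C; Y \<in> Obj C\<rbrakk> \<Longrightarrow> \<one> X \<boxtimes> \<one> Y = \<one> (X \<otimes> Y)"
    and interchange: "\<And>f g f' g'. \<lbrakk>f \<in> Arr C; g \<in> Arr C; f' \<in> Arr C; g' \<in> Arr C; Dom C f' = Cod C f; Dom C g' = Cod C g\<rbrakk>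
      \<Longrightarrow> (f' \<cdot> f) \<boxtimes> (g' \<cdot> g) = (f' \<boxtimes> g') \<cdot> (f \<boxtimes> g)"
    and Unit_Obj: "Unit C \<in> Obj C"
    and Assoc_Hom: "\<And>X Y Z. \<lbrakk>X \<in> Obj C; Y \<in> Obj C; Z \<in> Obj C\<rbrakk>
      \<Longrightarrow> \<alpha> X Y Z \<in> Hom C ((X \<otimes> Y) \<otimes> Z) (X \<otimes> Y \<otimes> Z)"
    and Assoc_natural: "\<And>f g h. \<lbrakk>f \<in> Arr C; g \<in> Arr C; h \<in> Arr C\<rbrakk> \<Longrightarrow>
      (f \<boxtimes> g \<boxtimes> h) \<cdot> \<alpha> (Dom C f) (Dom C g) (Dom C h) = \<alpha> (Cod C f) (Cod C g) (Cod C h) \<cdot> ((f \<boxtimes> g) \<boxtimes> h)"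
    and Assoc_iso: "\<And>X Y Z. \<lbrakk>X \<in> Obj C; Y \<in> Obj C; Z \<in> Obj C\<rbrakk> \<Longrightarrow> iso C (\<alpha> X Y Z)"
    and LUnit_Hom: "\<And>X. X \<in> Obj C \<Longrightarrow> LUnit C X \<in> Hom C (Unit C \<otimes> X) X"
    and LUnit_natural: "\<And>f. f \<in> Arr C \<Longrightarrow> f \<cdot> LUnit C (Dom C f) = LUnit C (Cod C f) \<cdot> (\<one> (Unit C) \<boxtimes> f)"
    and LUnit_iso: "\<And>X. X \<in> Obj C \<Longrightarrow> iso C (LUnit C X)"
    and RUnit_Hom: "\<And>X. X \<in> Obj C \<Longrightarrow> RUnit C X \<in> Hom C (X \<otimes> Unit C) X"
    and RUnit_natural: "\<And>f. f \<in> Arr C \<Longrightarrow> f \<cdot> RUnit C (Dom C f) = RUnit C (Cod C f) \<cdot> (f \<boxtimes> \<one> (Unit C))"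
    and RUnit_iso: "\<And>X. X \<in> Obj C \<Longrightarrow> iso C (RUnit C X)"
    and pentagon: "\<And>W X Y Z. \<lbrakk>W \<in> Obj C; X \<in> Obj C; Y \<in> Obj C; Z \<in> Obj C\<rbrakk> \<Longrightarrow>
      (\<one> W \<boxtimes> \<alpha> X Y Z) \<cdot> \<alpha> W (X \<otimes> Y) Z \<cdot> (\<alpha> W X Y \<boxtimes> \<one> Z)
        = \<alpha> W X (Y \<otimes> Z) \<cdot> \<alpha> (W \<otimes> X) Y Z"
    and triangle: "\<And>X Y. \<lbrakk>X \<in> Obj C; Y \<in> Obj C\<rbrakk> \<Longrightarrow>
      (\<one> X \<boxtimes> LUnit C Y) \<cdot> \<alpha> X (Unit C) Y = RUnit C X \<boxtimes> \<one> Y"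
  shows "monoidal_category C"
proof -
  interpret category C by fact
  have t [simp]: "f \<boxtimes> g \<in> Arr C" "Dom C (f \<boxtimes> g) = Dom C f \<otimes> Dom C g"
      "Cod C (f \<boxtimes> g) = Cod C f \<otimes> Cod C g" if "f \<in> Arr C" "g \<in> Arr C" for f g
    using tensor[OF that] by (auto simp: Hom_def)
  have o [simp]: "X \<otimes> Y \<in> Obj C" if "X \<in> Obj C" "Y \<in> Obj C" for X Y
    using t(2)[of "\<one> X" "\<one> Y"] Dom_Obj[of "\<one> X \<boxtimes> \<one> Y"] that by simp
  have w [simp]: "\<one> X \<boxtimes> (g \<cdot> f) = (\<one> X \<boxtimes> g) \<cdot> (\<one> X \<boxtimes> f)" "(g \<cdot> f) \<boxtimes> \<one> X = (g \<boxtimes> \<one> X) \<cdot> (f \<boxtimes> \<one> X)"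
    if "f \<in> Arr C" "g \<in> Arr C" "Dom C g = Cod C f" "X \<in> Obj C" for f g X
    using that by (simp_all flip: interchange)
  note [simp] = tensor_Idt interchange Unit_Obj
  have CC: "category (C \<times>\<^sub>C C)" and CCC: "category (C \<times>\<^sub>C C \<times>\<^sub>C C)"
    by (intro category_prod_cat; fact)+
  have "is_functor (C \<times>\<^sub>C C) C (tensor C)"
    by (rule is_functorI[OF CC \<open>category C\<close>]) (auto simp: tensor_def Hom_def)
  moreover have "nat_trans (C \<times>\<^sub>C C \<times>\<^sub>C C) C
      \<lparr>OMap = (\<lambda>(X, Y, Z). (X \<otimes> Y) \<otimes> Z), AMap = (\<lambda>(f, g, h). (f \<boxtimes> g) \<boxtimes> h)\<rparr>
      \<lparr>OMap = (\<lambda>(X, Y, Z). X \<otimes> (Y \<otimes> Z)), AMap = (\<lambda>(f, g, h). f \<boxtimes> (g \<boxtimes> h))\<rparr>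
      (\<lambda>(X, Y, Z). \<alpha> X Y Z)"
    by (subst nat_trans_iff; (rule is_functorI[OF CCC \<open>category C\<close>])?)
      (auto simp: Hom_def Assoc_natural Assoc_Hom[unfolded Hom_def, simplified])
  moreover have "nat_trans C C
      \<lparr>OMap = (\<lambda>X. Unit C \<otimes> X), AMap = (\<lambda>f. \<one> (Unit C) \<boxtimes> f)\<rparr> id_func (LUnit C)"
    by (subst nat_trans_iff; (rule is_functorI[OF \<open>category C\<close> \<open>category C\<close>])?)
      (auto simp: Hom_def LUnit_natural LUnit_Hom[unfolded Hom_def, simplified])
  moreover have "nat_trans C C
      \<lparr>OMap = (\<lambda>X. X \<otimes> Unit C), AMap = (\<lambda>f. f \<boxtimes> \<one> (Unit C))\<rparr> id_func (RUnit C)"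
    by (subst nat_trans_iff; (rule is_functorI[OF \<open>category C\<close> \<open>category C\<close>])?)
      (auto simp: Hom_def RUnit_natural RUnit_Hom[unfolded Hom_def, simplified])
  ultimately show ?thesis
    unfolding monoidal_category_def monoidal_category_axioms_def
    using Assoc_iso LUnit_iso RUnit_iso pentagon triangle Unit_Obj \<open>category C\<close> by blast
qed

section \<open>The reversed monoidal category\<close>

text \<open>
  The associator must be inverted, since reversing the factors turns \<open>(X \<otimes> Y) \<otimes> Z\<close> into
  \<open>Z \<otimes> (Y \<otimes> X)\<close>.
\<close>

definition rev_monoidal :: "('o, 'm, 'z) monoidal_category_scheme \<Rightarrow> ('o, 'm, 'z) monoidal_category_scheme" where
  "rev_monoidal C = C\<lparr>
     TOb := (\<lambda>X Y. Y \<otimes>\<^bsub>C\<^esub> X), TAr := (\<lambda>f g. g \<boxtimes>\<^bsub>C\<^esub> f),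
     Assoc := (\<lambda>X Y Z. inverse_of C (\<alpha>\<^bsub>C\<^esub> Z Y X)), LUnit := RUnit C, RUnit := LUnit C\<rparr>"

lemma rev_monoidal_simps [simp]:
  "Obj (rev_monoidal C) = Obj C" "Arr (rev_monoidal C) = Arr C"
  "Dom (rev_monoidal C) = Dom C" "Cod (rev_monoidal C) = Cod C"
  "Idt (rev_monoidal C) = Idt C" "Comp (rev_monoidal C) = Comp C"
  "TOb (rev_monoidal C) X Y = TOb C Y X" "TAr (rev_monoidal C) f g = TAr C g f"
  "Unit (rev_monoidal C) = Unit C"
  "Assoc (rev_monoidal C) X Y Z = inverse_of C (Assoc C Z Y X)"
  "LUnit (rev_monoidal C) = RUnit C" "RUnit (rev_monoidal C) = LUnit C"
  by (simp_all add: rev_monoidal_def)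

lemma rev_monoidal_Hom [simp]: "Hom (rev_monoidal C) = Hom C"
  by (intro ext) (simp add: Hom_def)

lemma rev_monoidal_is_inverse [simp]: "is_inverse (rev_monoidal C) = is_inverse C"
  by (intro ext) (simp add: is_inverse_def)

lemma rev_monoidal_iso [simp]: "iso (rev_monoidal C) = iso C"
  "inverse_of (rev_monoidal C) = inverse_of C"
  by (intro ext; simp add: iso_def inverse_of_def)+

lemma category_rev_monoidal [simp]: "category (rev_monoidal C) \<longleftrightarrow> category C"
  by (simp add: category_def)

lemma is_functor_rev_monoidal [simp]:
  "is_functor (rev_monoidal C) (rev_monoidal D) F \<longleftrightarrow> is_functor C D F"
  by (simp add: is_functor_def is_functor_axioms_def)

lemma monoidal_category_rev_monoidal:
  assumes "monoidal_category C"
  shows "monoidal_category (rev_monoidal C)"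
proof -
  interpret monoidal_category C by fact
  show ?thesis
  proof (rule monoidal_categoryI)
    show "category (rev_monoidal C)" using category_axioms by simp
  qed (simp_all add: Hom_def interchange Assoc_inv_natural LUnit_natural RUnit_natural pentagon_inv
      triangle_inv)
qed

section \<open>One-sided coactions\<close>

text \<open>
  The multiplication \<open>c\<close> and the counit \<open>e\<close> are parameters separate from \<open>G\<close>, so that they can be
  \<open>Gcheck G\<close> in a monoidal category, or \<open>Ghat G\<close> with its arguments exchanged in the reversed
  one.
\<close>

locale right_multiplication = monoidal_category C + is_functor C C G for C (structure) and G +
  fixes c :: "'a \<Rightarrow> 'a \<Rightarrow> 'b" and e :: "'a \<Rightarrow> 'b"
  assumes c_Hom: "\<lbrakk>X \<in> Obj C; Y \<in> Obj C\<rbrakk>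
      \<Longrightarrow> c X Y \<in> Hom C (G $\<^sub>o X \<otimes> G $\<^sub>o Y) (G $\<^sub>o (G $\<^sub>o X \<otimes> Y))"
    and c_natural': "\<lbrakk>f \<in> Arr C; g \<in> Arr C\<rbrakk> \<Longrightarrow>
      G $\<^sub>a (G $\<^sub>a f \<boxtimes> g) \<cdot> c (Dom C f) (Dom C g) = c (Cod C f) (Cod C g) \<cdot> (G $\<^sub>a f \<boxtimes> G $\<^sub>a g)"
    and e_Hom: "X \<in> Obj C \<Longrightarrow> e X \<in> Hom C (G $\<^sub>o X) X"
    and e_natural': "f \<in> Arr C \<Longrightarrow> f \<cdot> e (Dom C f) = e (Cod C f) \<cdot> G $\<^sub>a f"
begin

lemma c_simps [simp]:
  assumes "X \<in> Obj C" "Y \<in> Obj C"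
  shows "c X Y \<in> Arr C" "Dom C (c X Y) = G $\<^sub>o X \<otimes> G $\<^sub>o Y" "Cod C (c X Y) = G $\<^sub>o (G $\<^sub>o X \<otimes> Y)"
  using c_Hom[OF assms] by (auto simp: Hom_def)

lemma e_simps [simp]:
  assumes "X \<in> Obj C"
  shows "e X \<in> Arr C" "Dom C (e X) = G $\<^sub>o X" "Cod C (e X) = X"
  using e_Hom[OF assms] by (auto simp: Hom_def)

lemma c_natural:
  "\<lbrakk>f \<in> Arr C; g \<in> Arr C; Dom C f = X; Dom C g = Y\<rbrakk> \<Longrightarrow>
    G $\<^sub>a (G $\<^sub>a f \<boxtimes> g) \<cdot> c X Y = c (Cod C f) (Cod C g) \<cdot> (G $\<^sub>a f \<boxtimes> G $\<^sub>a g)"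
  using c_natural' by auto

lemma c_natural1:
  "\<lbrakk>f \<in> Arr C; Y \<in> Obj C; Dom C f = X\<rbrakk> \<Longrightarrow>
    G $\<^sub>a (G $\<^sub>a f \<boxtimes> \<one> Y) \<cdot> c X Y = c (Cod C f) Y \<cdot> (G $\<^sub>a f \<boxtimes> \<one> (G $\<^sub>o Y))"
  using c_natural[of f "\<one> Y"] by auto

lemma e_natural:
  "\<lbrakk>f \<in> Arr C; Cod C f = X\<rbrakk> \<Longrightarrow> e X \<cdot> G $\<^sub>a f = f \<cdot> e (Dom C f)"
  using e_natural' by auto

end

text \<open>
  In \<open>v_c\<close> the associator stands on the right-hand side: the common domain is bracketed to the right,
  which in the reversed category means bracketing to the left, so that there the axiom has
  literally the form of the comodule axiom for \<open>vhat\<close> and \<open>Ghat\<close>.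
\<close>

locale right_coaction = right_multiplication C G c e for C (structure) and G c e +
  fixes V :: 'a and v :: "'a \<Rightarrow> 'b"
  assumes V_Obj [simp]: "V \<in> Obj C"
    and v_Hom: "X \<in> Obj C \<Longrightarrow> v X \<in> Hom C (V \<otimes> G $\<^sub>o X) (G $\<^sub>o (V \<otimes> X))"
    and v_natural': "f \<in> Arr C \<Longrightarrow>
      G $\<^sub>a (\<one> V \<boxtimes> f) \<cdot> v (Dom C f) = v (Cod C f) \<cdot> (\<one> V \<boxtimes> G $\<^sub>a f)"
    and v_c: "\<lbrakk>X \<in> Obj C; Y \<in> Obj C\<rbrakk> \<Longrightarrow>
      G $\<^sub>a (v X \<boxtimes> \<one> Y) \<cdot> G $\<^sub>a (\<a> V (G $\<^sub>o X) Y) \<cdot> v (G $\<^sub>o X \<otimes> Y) \<cdot> (\<one> V \<boxtimes> c X Y)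
        = c (V \<otimes> X) Y \<cdot> (v X \<boxtimes> \<one> (G $\<^sub>o Y)) \<cdot> \<a> V (G $\<^sub>o X) (G $\<^sub>o Y)"
    and e_v: "X \<in> Obj C \<Longrightarrow> e (V \<otimes> X) \<cdot> v X = \<one> V \<boxtimes> e X"
begin

lemma v_simps [simp]:
  assumes "X \<in> Obj C"
  shows "v X \<in> Arr C" "Dom C (v X) = V \<otimes> G $\<^sub>o X" "Cod C (v X) = G $\<^sub>o (V \<otimes> X)"
  using v_Hom[OF assms] by (auto simp: Hom_def)

lemma v_natural:
  "\<lbrakk>f \<in> Arr C; Cod C f = X\<rbrakk> \<Longrightarrow>
    v X \<cdot> (\<one> V \<boxtimes> G $\<^sub>a f) = G $\<^sub>a (\<one> V \<boxtimes> f) \<cdot> v (Dom C f)"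
  using v_natural' by auto

lemma v_natural_rev:
  "\<lbrakk>f \<in> Arr C; Dom C f = X\<rbrakk> \<Longrightarrow>
    G $\<^sub>a (\<one> V \<boxtimes> f) \<cdot> v X = v (Cod C f) \<cdot> (\<one> V \<boxtimes> G $\<^sub>a f)"
  using v_natural' by auto

end

definition tensor_coaction ::
  "('o, 'm, 'z) monoidal_category_scheme \<Rightarrow> ('o, 'm, 'o, 'm, 'y) func_scheme
    \<Rightarrow> 'o \<Rightarrow> ('o \<Rightarrow> 'm) \<Rightarrow> 'o \<Rightarrow> ('o \<Rightarrow> 'm) \<Rightarrow> 'o \<Rightarrow> 'm" where
  "tensor_coaction C G V v W w X =
     G $\<^sub>a (inverse_of C (\<alpha>\<^bsub>C\<^esub> V W X)) \<cdot>\<^bsub>C\<^esub> v (W \<otimes>\<^bsub>C\<^esub> X) \<cdot>\<^bsub>C\<^esub> (\<one>\<^bsub>C\<^esub> V \<boxtimes>\<^bsub>C\<^esub> w X)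
       \<cdot>\<^bsub>C\<^esub> \<alpha>\<^bsub>C\<^esub> V W (G $\<^sub>o X)"

definition unit_coaction ::
  "('o, 'm, 'z) monoidal_category_scheme \<Rightarrow> ('o, 'm, 'o, 'm, 'y) func_scheme \<Rightarrow> 'o \<Rightarrow> 'm" where
  "unit_coaction C G X = G $\<^sub>a (inverse_of C (LUnit C X)) \<cdot>\<^bsub>C\<^esub> LUnit C (G $\<^sub>o X)"

definition coaction_hom ::
  "('o, 'm, 'z) monoidal_category_scheme \<Rightarrow> ('o, 'm, 'o, 'm, 'y) func_scheme
    \<Rightarrow> 'o \<Rightarrow> ('o \<Rightarrow> 'm) \<Rightarrow> 'o \<Rightarrow> ('o \<Rightarrow> 'm) \<Rightarrow> 'm \<Rightarrow> bool" where
  "coaction_hom C G V v W w f \<longleftrightarrow> f \<in> Hom C V W \<and>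
     (\<forall>X \<in> Obj C. G $\<^sub>a (f \<boxtimes>\<^bsub>C\<^esub> \<one>\<^bsub>C\<^esub> X) \<cdot>\<^bsub>C\<^esub> v X = w X \<cdot>\<^bsub>C\<^esub> (f \<boxtimes>\<^bsub>C\<^esub> \<one>\<^bsub>C\<^esub> (G $\<^sub>o X)))"

context right_multiplication
begin

text \<open>
  Each axiom for \<open>V \<otimes> W\<close> is obtained by using the axiom for \<open>W\<close> inside \<open>V \<otimes> -\<close> and then the axiom for
  \<open>V\<close>, with the naturality of \<open>v\<close> to pass between the two. In the multiplication axiom the associators
  that this creates are removed by one pentagon under \<open>G\<close> in the codomain and one in the
  domain.
\<close>

lemma right_coaction_tensor:
  assumes "right_coaction C G c e V v" "right_coaction C G c e W w"
  shows "right_coaction C G c e (V \<otimes> W) (tensor_coaction C G V v W w)"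
proof -
  interpret V: right_coaction C G c e V v by fact
  interpret W: right_coaction C G c e W w by fact
  let ?t = "tensor_coaction C G V v W w"
  show ?thesis
  proof
    show "V \<otimes> W \<in> Obj C" by simp
  next
    fix X assume X: "X \<in> Obj C"
    then show "?t X \<in> Hom C ((V \<otimes> W) \<otimes> G $\<^sub>o X) (G $\<^sub>o ((V \<otimes> W) \<otimes> X))"
      by (simp add: Hom_def tensor_coaction_def)
  next
    fix f assume f: "f \<in> Arr C"
    have "G $\<^sub>a (\<one> (V \<otimes> W) \<boxtimes> f) \<cdot> G $\<^sub>a (\<a> V W (Dom C f)) = G $\<^sub>a (\<a> V W (Cod C f)) \<cdot> G $\<^sub>a (\<one> V \<boxtimes> \<one> W \<boxtimes> f)"
      using f Assoc_inv_natural[of "\<one> V" "\<one> W" f] by (simp flip: AMap_comp)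
    note 1 = reassoc2[OF this]
    have "(\<one> V \<boxtimes> w (Cod C f)) \<cdot> (\<one> V \<boxtimes> \<one> W \<boxtimes> G $\<^sub>a f) = (\<one> V \<boxtimes> G $\<^sub>a (\<one> W \<boxtimes> f)) \<cdot> (\<one> V \<boxtimes> w (Dom C f))"
      using f by (simp flip: whisker_comp add: W.v_natural)
    note 2 = reassoc2[OF this]
    show "G $\<^sub>a (\<one> (V \<otimes> W) \<boxtimes> f) \<cdot> ?t (Dom C f) = ?t (Cod C f) \<cdot> (\<one> (V \<otimes> W) \<boxtimes> G $\<^sub>a f)"
      using f by (simp add: tensor_coaction_def 1 Assoc_natural3 2 reassoc2[OF V.v_natural])
  next
    fix X Y assume X: "X \<in> Obj C" and Y: "Y \<in> Obj C"
    let ?P = "G $\<^sub>a (G $\<^sub>a (\<a> V W X) \<boxtimes> \<one> Y)"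
    have p1: "G $\<^sub>a (\<alpha> V W (G $\<^sub>o X) \<boxtimes> \<one> Y) \<cdot> G $\<^sub>a (\<a> (V \<otimes> W) (G $\<^sub>o X) Y) \<cdot> G $\<^sub>a (\<a> V W (G $\<^sub>o X \<otimes> Y))
      = G $\<^sub>a (\<a> V (W \<otimes> G $\<^sub>o X) Y) \<cdot> G $\<^sub>a (\<one> V \<boxtimes> \<a> W (G $\<^sub>o X) Y)"
      using X Y pentagon_mixed(1)[of V W "G $\<^sub>o X" Y] by (simp flip: AMap_comp)
    have p2: "G $\<^sub>a ((\<one> V \<boxtimes> w X) \<boxtimes> \<one> Y) \<cdot> G $\<^sub>a (\<a> V (W \<otimes> G $\<^sub>o X) Y)
      = G $\<^sub>a (\<a> V (G $\<^sub>o (W \<otimes> X)) Y) \<cdot> G $\<^sub>a (\<one> V \<boxtimes> w X \<boxtimes> \<one> Y)"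
      using X Y Assoc_inv_natural[of "\<one> V" "w X" "\<one> Y"] by (simp flip: AMap_comp)
    have p3: "(\<one> V \<boxtimes> G $\<^sub>a (w X \<boxtimes> \<one> Y)) \<cdot> (\<one> V \<boxtimes> G $\<^sub>a (\<a> W (G $\<^sub>o X) Y)) \<cdot> (\<one> V \<boxtimes> w (G $\<^sub>o X \<otimes> Y)) \<cdot> (\<one> V \<boxtimes> \<one> W \<boxtimes> c X Y)
      = (\<one> V \<boxtimes> c (W \<otimes> X) Y) \<cdot> (\<one> V \<boxtimes> w X \<boxtimes> \<one> (G $\<^sub>o Y)) \<cdot> (\<one> V \<boxtimes> \<a> W (G $\<^sub>o X) (G $\<^sub>o Y))"
      using X Y W.v_c[of X Y] by (simp flip: whisker_comp)
    \<comment> \<open>The pentagon makes \<open>w\<close> and the associator of \<open>W\<close> adjacent under \<open>G (V \<otimes> -)\<close>, as in the axiom for \<open>W\<close>.\<close>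
    have "G $\<^sub>a (?t X \<boxtimes> \<one> Y) \<cdot> G $\<^sub>a (\<a> (V \<otimes> W) (G $\<^sub>o X) Y) \<cdot> ?t (G $\<^sub>o X \<otimes> Y) \<cdot> (\<one> (V \<otimes> W) \<boxtimes> c X Y)
      = ?P \<cdot> G $\<^sub>a (v (W \<otimes> X) \<boxtimes> \<one> Y) \<cdot> G $\<^sub>a (\<a> V (G $\<^sub>o (W \<otimes> X)) Y) \<cdot> G $\<^sub>a (\<one> V \<boxtimes> w X \<boxtimes> \<one> Y)
        \<cdot> G $\<^sub>a (\<one> V \<boxtimes> \<a> W (G $\<^sub>o X) Y) \<cdot> v (W \<otimes> G $\<^sub>o X \<otimes> Y) \<cdot> (\<one> V \<boxtimes> w (G $\<^sub>o X \<otimes> Y)) \<cdot> (\<one> V \<boxtimes> \<one> W \<boxtimes> c X Y)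
        \<cdot> \<alpha> V W (G $\<^sub>o X \<otimes> G $\<^sub>o Y)"
      using X Y by (simp add: tensor_coaction_def reassoc3[OF p1] reassoc2[OF p2] Assoc_natural3)
    also have "\<dots> = ?P \<cdot> G $\<^sub>a (v (W \<otimes> X) \<boxtimes> \<one> Y) \<cdot> G $\<^sub>a (\<a> V (G $\<^sub>o (W \<otimes> X)) Y) \<cdot> v (G $\<^sub>o (W \<otimes> X) \<otimes> Y)
        \<cdot> (\<one> V \<boxtimes> c (W \<otimes> X) Y) \<cdot> (\<one> V \<boxtimes> w X \<boxtimes> \<one> (G $\<^sub>o Y)) \<cdot> (\<one> V \<boxtimes> \<a> W (G $\<^sub>o X) (G $\<^sub>o Y))
        \<cdot> \<alpha> V W (G $\<^sub>o X \<otimes> G $\<^sub>o Y)"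
      using X Y by (simp add: reassoc2[OF V.v_natural_rev] reassoc4[OF p3])
    also have "\<dots> = ?P \<cdot> c (V \<otimes> W \<otimes> X) Y \<cdot> (v (W \<otimes> X) \<boxtimes> \<one> (G $\<^sub>o Y)) \<cdot> \<a> V (G $\<^sub>o (W \<otimes> X)) (G $\<^sub>o Y)
        \<cdot> (\<one> V \<boxtimes> w X \<boxtimes> \<one> (G $\<^sub>o Y)) \<cdot> (\<one> V \<boxtimes> \<a> W (G $\<^sub>o X) (G $\<^sub>o Y)) \<cdot> \<alpha> V W (G $\<^sub>o X \<otimes> G $\<^sub>o Y)"
      using X Y by (simp add: reassoc4[OF V.v_c])
    also have "\<dots> = c ((V \<otimes> W) \<otimes> X) Y \<cdot> (?t X \<boxtimes> \<one> (G $\<^sub>o Y)) \<cdot> \<a> (V \<otimes> W) (G $\<^sub>o X) (G $\<^sub>o Y)"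
      using X Y by (simp add: tensor_coaction_def reassoc2[OF c_natural1] reassoc2[OF Assoc_inv_natural] pentagon_mixed(2))
    finally show "G $\<^sub>a (?t X \<boxtimes> \<one> Y) \<cdot> G $\<^sub>a (\<a> (V \<otimes> W) (G $\<^sub>o X) Y) \<cdot> ?t (G $\<^sub>o X \<otimes> Y) \<cdot> (\<one> (V \<otimes> W) \<boxtimes> c X Y)
      = c ((V \<otimes> W) \<otimes> X) Y \<cdot> (?t X \<boxtimes> \<one> (G $\<^sub>o Y)) \<cdot> \<a> (V \<otimes> W) (G $\<^sub>o X) (G $\<^sub>o Y)" .
  next
    fix X assume X: "X \<in> Obj C"
    have 1: "(\<one> V \<boxtimes> e (W \<otimes> X)) \<cdot> (\<one> V \<boxtimes> w X) = \<one> V \<boxtimes> \<one> W \<boxtimes> e X"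
      using X by (simp flip: whisker_comp add: W.e_v)
    have 2: "(\<one> V \<boxtimes> \<one> W \<boxtimes> e X) \<cdot> \<alpha> V W (G $\<^sub>o X) = \<alpha> V W X \<cdot> (\<one> (V \<otimes> W) \<boxtimes> e X)"
      using X by (simp add: Assoc_natural3)
    show "e ((V \<otimes> W) \<otimes> X) \<cdot> ?t X = \<one> (V \<otimes> W) \<boxtimes> e X"
      using X by (simp add: tensor_coaction_def reassoc2[OF e_natural] reassoc2[OF V.e_v] reassoc2[OF 1] 2)
  qed
qed

text \<open>
  The unit coaction is a composite of unit isomorphisms, so the axioms reduce to naturality of
  \<open>c\<close>, \<open>e\<close> and the left unitor, once \<open>LUnit_tensor\<close> has identified the unitor of a tensor product.
\<close>

lemma right_coaction_unit: "right_coaction C G c e (Unit C) (unit_coaction C G)"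
proof
  show "Unit C \<in> Obj C" by simp
next
  fix X assume "X \<in> Obj C"
  then show "unit_coaction C G X \<in> Hom C (Unit C \<otimes> G $\<^sub>o X) (G $\<^sub>o (Unit C \<otimes> X))"
    by (simp add: unit_coaction_def Hom_def)
next
  fix f assume f: "f \<in> Arr C"
  have 1: "G $\<^sub>a (\<one> (Unit C) \<boxtimes> f) \<cdot> G $\<^sub>a (inverse_of C (LUnit C (Dom C f)))
      = G $\<^sub>a (inverse_of C (LUnit C (Cod C f))) \<cdot> G $\<^sub>a f"
    using f LUnit_inv_natural[of f] by (simp flip: AMap_comp)
  show "G $\<^sub>a (\<one> (Unit C) \<boxtimes> f) \<cdot> unit_coaction C G (Dom C f)
      = unit_coaction C G (Cod C f) \<cdot> (\<one> (Unit C) \<boxtimes> G $\<^sub>a f)"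
    using f by (simp add: unit_coaction_def reassoc2[OF 1] LUnit_natural)
next
  fix X Y assume X: "X \<in> Obj C" and Y: "Y \<in> Obj C"
  have 1: "G $\<^sub>a (LUnit C (G $\<^sub>o X) \<boxtimes> \<one> Y) \<cdot> G $\<^sub>a (\<a> (Unit C) (G $\<^sub>o X) Y) = G $\<^sub>a (LUnit C (G $\<^sub>o X \<otimes> Y))"
    using X Y by (simp flip: AMap_comp LUnit_tensor_inv)
  show "G $\<^sub>a (unit_coaction C G X \<boxtimes> \<one> Y) \<cdot> G $\<^sub>a (\<a> (Unit C) (G $\<^sub>o X) Y)
        \<cdot> unit_coaction C G (G $\<^sub>o X \<otimes> Y) \<cdot> (\<one> (Unit C) \<boxtimes> c X Y)
      = c (Unit C \<otimes> X) Y \<cdot> (unit_coaction C G X \<boxtimes> \<one> (G $\<^sub>o Y)) \<cdot> \<a> (Unit C) (G $\<^sub>o X) (G $\<^sub>o Y)"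
    using X Y by (simp add: unit_coaction_def reassoc2[OF 1] LUnit_tensor_inv LUnit_natural
      reassoc2[OF c_natural1])
next
  fix X assume X: "X \<in> Obj C"
  then have 1: "e X \<cdot> LUnit C (G $\<^sub>o X) = LUnit C X \<cdot> (\<one> (Unit C) \<boxtimes> e X)"
    by (simp add: LUnit_natural)
  show "e (Unit C \<otimes> X) \<cdot> unit_coaction C G X = \<one> (Unit C) \<boxtimes> e X"
    using X by (simp add: unit_coaction_def reassoc2[OF e_natural] 1)
qed

lemma coaction_hom_inverse:
  assumes "coaction_hom C G V v W w f" "iso C f"
    "right_coaction C G c e V v" "right_coaction C G c e W w"
  shows "coaction_hom C G W w V v (inverse_of C f)"
proof -
  interpret V: right_coaction C G c e V v by fact
  interpret W: right_coaction C G c e W w by fact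
  have f [simp]: "Dom C f = V" "Cod C f = W" and h: "\<And>X. X \<in> Obj C \<Longrightarrow>
      G $\<^sub>a (f \<boxtimes> \<one> X) \<cdot> v X = w X \<cdot> (f \<boxtimes> \<one> (G $\<^sub>o X))"
    using assms(1) by (auto simp: coaction_hom_def Hom_def)
  have "G $\<^sub>a (inverse_of C f \<boxtimes> \<one> X) \<cdot> w X = v X \<cdot> (inverse_of C f \<boxtimes> \<one> (G $\<^sub>o X))"
    if X: "X \<in> Obj C" for X
  proof (rule iso_left_cancel[of "G $\<^sub>a (f \<boxtimes> \<one> X)"])
    show "G $\<^sub>a (f \<boxtimes> \<one> X) \<cdot> G $\<^sub>a (inverse_of C f \<boxtimes> \<one> X) \<cdot> w X
        = G $\<^sub>a (f \<boxtimes> \<one> X) \<cdot> v X \<cdot> (inverse_of C f \<boxtimes> \<one> (G $\<^sub>o X))"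
      using X assms(2) by (simp add: reassoc2[OF h])
  qed (use X assms(2) in auto)
  then show ?thesis
    using assms(2) by (simp add: coaction_hom_def Hom_def)
qed

text \<open>
  Writing \<open>f \<otimes> g\<close> as \<open>g\<close> followed by \<open>f\<close>, first \<open>g\<close> passes \<open>w\<close>, and then \<open>f\<close> passes the coaction
  of \<open>V\<close>.
\<close>

lemma coaction_hom_tensor:
  assumes "coaction_hom C G V v V' v' f" "coaction_hom C G W w W' w' g"
    "right_coaction C G c e V v" "right_coaction C G c e W w"
    "right_coaction C G c e V' v'" "right_coaction C G c e W' w'"
  shows "coaction_hom C G (V \<otimes> W) (tensor_coaction C G V v W w)
    (V' \<otimes> W') (tensor_coaction C G V' v' W' w') (f \<boxtimes> g)"
proof -
  interpret V: right_coaction C G c e V v by fact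
  interpret W: right_coaction C G c e W w by fact
  interpret V': right_coaction C G c e V' v' by fact
  interpret W': right_coaction C G c e W' w' by fact
  have f [simp]: "f \<in> Arr C" "Dom C f = V" "Cod C f = V'" and hf: "\<And>X. X \<in> Obj C \<Longrightarrow>
      G $\<^sub>a (f \<boxtimes> \<one> X) \<cdot> v X = v' X \<cdot> (f \<boxtimes> \<one> (G $\<^sub>o X))"
    using assms(1) by (auto simp: coaction_hom_def Hom_def)
  have g [simp]: "g \<in> Arr C" "Dom C g = W" "Cod C g = W'" and hg: "\<And>X. X \<in> Obj C \<Longrightarrow>
      G $\<^sub>a (g \<boxtimes> \<one> X) \<cdot> w X = w' X \<cdot> (g \<boxtimes> \<one> (G $\<^sub>o X))"
    using assms(2) by (auto simp: coaction_hom_def Hom_def)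
  have "G $\<^sub>a ((f \<boxtimes> g) \<boxtimes> \<one> X) \<cdot> tensor_coaction C G V v W w X
      = tensor_coaction C G V' v' W' w' X \<cdot> ((f \<boxtimes> g) \<boxtimes> \<one> (G $\<^sub>o X))" (is "?l = ?r")
    if X: "X \<in> Obj C" for X
  proof -
    have 1: "G $\<^sub>a ((f \<boxtimes> g) \<boxtimes> \<one> X) \<cdot> G $\<^sub>a (\<a> V W X)
        = G $\<^sub>a (\<a> V' W' X) \<cdot> G $\<^sub>a (f \<boxtimes> \<one> (W' \<otimes> X)) \<cdot> G $\<^sub>a (\<one> V \<boxtimes> g \<boxtimes> \<one> X)"
      using X Assoc_inv_natural[of f g "\<one> X" V' W' X]
      by (simp flip: AMap_comp add: tensor_split[of f "g \<boxtimes> \<one> X"])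
    have 2: "(\<one> V \<boxtimes> G $\<^sub>a (g \<boxtimes> \<one> X)) \<cdot> (\<one> V \<boxtimes> w X) = (\<one> V \<boxtimes> w' X) \<cdot> (\<one> V \<boxtimes> g \<boxtimes> \<one> (G $\<^sub>o X))"
      using X by (simp flip: whisker_comp add: hg)
    have 3: "(\<one> V' \<boxtimes> w' X) \<cdot> (f \<boxtimes> g \<boxtimes> \<one> (G $\<^sub>o X))
        = (f \<boxtimes> \<one> (G $\<^sub>o (W' \<otimes> X))) \<cdot> (\<one> V \<boxtimes> w' X) \<cdot> (\<one> V \<boxtimes> g \<boxtimes> \<one> (G $\<^sub>o X))"
      using X by (simp add: interchange flip: whisker_comp)
    have "?l = G $\<^sub>a (\<a> V' W' X) \<cdot> v' (W' \<otimes> X) \<cdot> (f \<boxtimes> \<one> (G $\<^sub>o (W' \<otimes> X)))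
        \<cdot> (\<one> V \<boxtimes> w' X) \<cdot> (\<one> V \<boxtimes> g \<boxtimes> \<one> (G $\<^sub>o X)) \<cdot> \<alpha> V W (G $\<^sub>o X)"
      using X by (simp add: tensor_coaction_def reassoc2[OF 1] reassoc2[OF V.v_natural_rev]
        reassoc2[OF 2] reassoc2[OF hf])
    also have "\<dots> = ?r"
      using X by (simp add: tensor_coaction_def Assoc_natural reassoc2[OF 3])
    finally show ?thesis .
  qed
  then show ?thesis by (simp add: coaction_hom_def Hom_def)
qed

text \<open>
  Both coactions move \<open>Z\<close>, then \<open>W\<close>, then \<open>V\<close> into \<open>G\<close>; they differ only in the associators around
  these moves, and the two ways of rebracketing agree by a pentagon in the codomain, under \<open>G\<close>,
  and one in the domain.
\<close>

lemma coaction_hom_Assoc: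
  assumes "right_coaction C G c e V v" "right_coaction C G c e W w" "right_coaction C G c e Z z"
  shows "coaction_hom C G
    ((V \<otimes> W) \<otimes> Z) (tensor_coaction C G (V \<otimes> W) (tensor_coaction C G V v W w) Z z)
    (V \<otimes> W \<otimes> Z) (tensor_coaction C G V v (W \<otimes> Z) (tensor_coaction C G W w Z z))
    (\<alpha> V W Z)"
proof -
  interpret V: right_coaction C G c e V v by fact
  interpret W: right_coaction C G c e W w by fact
  interpret Z: right_coaction C G c e Z z by fact
  have "G $\<^sub>a (\<alpha> V W Z \<boxtimes> \<one> X) \<cdot> tensor_coaction C G (V \<otimes> W) (tensor_coaction C G V v W w) Z z X
      = tensor_coaction C G V v (W \<otimes> Z) (tensor_coaction C G W w Z z) X \<cdot> (\<alpha> V W Z \<boxtimes> \<one> (G $\<^sub>o X))"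
    if X: "X \<in> Obj C" for X
  proof -
    have "G $\<^sub>a (\<alpha> V W Z \<boxtimes> \<one> X) \<cdot> G $\<^sub>a (\<a> (V \<otimes> W) Z X) \<cdot> G $\<^sub>a (\<a> V W (Z \<otimes> X))
        = G $\<^sub>a (\<a> V (W \<otimes> Z) X) \<cdot> G $\<^sub>a (\<one> V \<boxtimes> \<a> W Z X)"
      using X pentagon_mixed(1)[of V W Z X] by (simp flip: AMap_comp)
    note 1 = reassoc3[OF this]
    show ?thesis
      using X by (simp add: tensor_coaction_def 1 reassoc2[OF Assoc_natural3]
        reassoc2[OF V.v_natural] pentagon)
  qed
  then show ?thesis by (simp add: coaction_hom_def Hom_def)
qed

text \<open>
  The unitor of \<open>V\<close>, applied under \<open>G\<close>, cancels against the unit coaction by the second triangle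
  identity \<open>LUnit_tensor\<close>. For the right unitor below, the first triangle identity has this role.
\<close>

lemma coaction_hom_LUnit:
  assumes "right_coaction C G c e V v"
  shows "coaction_hom C G (Unit C \<otimes> V) (tensor_coaction C G (Unit C) (unit_coaction C G) V v)
    V v (LUnit C V)"
proof -
  interpret V: right_coaction C G c e V v by fact
  have "G $\<^sub>a (LUnit C V \<boxtimes> \<one> X) \<cdot> tensor_coaction C G (Unit C) (unit_coaction C G) V v X
      = v X \<cdot> (LUnit C V \<boxtimes> \<one> (G $\<^sub>o X))"
    if X: "X \<in> Obj C" for X
  proof -
    have 1: "G $\<^sub>a (LUnit C V \<boxtimes> \<one> X) \<cdot> G $\<^sub>a (\<a> (Unit C) V X) = G $\<^sub>a (LUnit C (V \<otimes> X))"
      using X by (simp flip: AMap_comp LUnit_tensor_inv)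
    show ?thesis
      using X by (simp add: tensor_coaction_def unit_coaction_def reassoc2[OF 1]
        reassoc2[OF LUnit_natural] LUnit_tensor)
  qed
  then show ?thesis by (simp add: coaction_hom_def Hom_def)
qed

lemma coaction_hom_RUnit:
  assumes "right_coaction C G c e V v"
  shows "coaction_hom C G (V \<otimes> Unit C) (tensor_coaction C G V v (Unit C) (unit_coaction C G))
    V v (RUnit C V)"
proof -
  interpret V: right_coaction C G c e V v by fact
  have "G $\<^sub>a (RUnit C V \<boxtimes> \<one> X) \<cdot> tensor_coaction C G V v (Unit C) (unit_coaction C G) X
      = v X \<cdot> (RUnit C V \<boxtimes> \<one> (G $\<^sub>o X))"
    if X: "X \<in> Obj C" for X
  proof -
    have 1: "G $\<^sub>a (RUnit C V \<boxtimes> \<one> X) \<cdot> G $\<^sub>a (\<a> V (Unit C) X) = G $\<^sub>a (\<one> V \<boxtimes> LUnit C X)"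
      using X by (simp flip: AMap_comp triangle_inv)
    show ?thesis
      using X by (simp add: tensor_coaction_def unit_coaction_def reassoc2[OF 1]
        reassoc2[OF V.v_natural] triangle)
  qed
  then show ?thesis by (simp add: coaction_hom_def Hom_def)
qed

lemma coaction_hom_Idt:
  assumes "right_coaction C G c e V v"
  shows "coaction_hom C G V v V v (\<one> V)"
proof -
  interpret V: right_coaction C G c e V v by fact
  show ?thesis by (simp add: coaction_hom_def Hom_def)
qed

lemma coaction_hom_Comp:
  assumes "coaction_hom C G U u V v f" "coaction_hom C G V v W w g"
    "right_coaction C G c e U u" "right_coaction C G c e V v" "right_coaction C G c e W w"
  shows "coaction_hom C G U u W w (g \<cdot> f)"
proof -
  interpret U: right_coaction C G c e U u by fact
  interpret V: right_coaction C G c e V v by fact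
  interpret W: right_coaction C G c e W w by fact
  have f [simp]: "f \<in> Arr C" "Dom C f = U" "Cod C f = V" and hf: "\<And>X. X \<in> Obj C \<Longrightarrow>
      G $\<^sub>a (f \<boxtimes> \<one> X) \<cdot> u X = v X \<cdot> (f \<boxtimes> \<one> (G $\<^sub>o X))"
    using assms(1) by (auto simp: coaction_hom_def Hom_def)
  have g [simp]: "g \<in> Arr C" "Dom C g = V" "Cod C g = W" and hg: "\<And>X. X \<in> Obj C \<Longrightarrow>
      G $\<^sub>a (g \<boxtimes> \<one> X) \<cdot> v X = w X \<cdot> (g \<boxtimes> \<one> (G $\<^sub>o X))"
    using assms(2) by (auto simp: coaction_hom_def Hom_def)
  show ?thesis
    by (simp add: coaction_hom_def Hom_def hf reassoc2[OF hg])
qed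

end

section \<open>Comodules as compatible pairs of coactions\<close>

context multiplier_bicomonad
begin

lemma right_multiplication_Gcheck: "right_multiplication C G (Gcheck G) (counit G)"
proof
  fix X Y assume "X \<in> Obj C" "Y \<in> Obj C"
  then show "Gcheck G X Y \<in> Hom C (G $\<^sub>o X \<otimes> G $\<^sub>o Y) (G $\<^sub>o (G $\<^sub>o X \<otimes> Y))"
    using nat_trans.component_Hom[OF Gcheck_nat, of "(X, Y)"] by simp
next
  fix f g assume "f \<in> Arr C" "g \<in> Arr C"
  then show "G $\<^sub>a (G $\<^sub>a f \<boxtimes> g) \<cdot> Gcheck G (Dom C f) (Dom C g)
      = Gcheck G (Cod C f) (Cod C g) \<cdot> (G $\<^sub>a f \<boxtimes> G $\<^sub>a g)"
    using nat_trans.naturality[OF Gcheck_nat, of "(f, g)" "(Dom C f, Dom C g)" "(Cod C f, Cod C g)"]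
    by (simp add: Hom_def)
next
  fix X assume "X \<in> Obj C"
  then show "counit G X \<in> Hom C (G $\<^sub>o X) X"
    using nat_trans.component_Hom[OF counit_nat, of X] by simp
next
  fix f assume "f \<in> Arr C"
  then show "f \<cdot> counit G (Dom C f) = counit G (Cod C f) \<cdot> G $\<^sub>a f"
    using nat_trans.naturality[OF counit_nat, of f "Dom C f" "Cod C f"] by (simp add: Hom_def)
qed

lemma right_multiplication_Ghat:
  "right_multiplication (rev_monoidal C) G (\<lambda>X Y. Ghat G Y X) (counit G)"
proof (intro right_multiplication.intro right_multiplication_axioms.intro)
  show "monoidal_category (rev_monoidal C)"
    using monoidal_category_rev_monoidal monoidal_category_axioms by blast
  show "is_functor (rev_monoidal C) (rev_monoidal C) G"
    using is_functor_axioms by simp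
next
  fix X Y assume "X \<in> Obj (rev_monoidal C)" "Y \<in> Obj (rev_monoidal C)"
  then show "Ghat G Y X \<in> Hom (rev_monoidal C) (G $\<^sub>o X \<otimes>\<^bsub>rev_monoidal C\<^esub> G $\<^sub>o Y)
      (G $\<^sub>o (G $\<^sub>o X \<otimes>\<^bsub>rev_monoidal C\<^esub> Y))"
    using nat_trans.component_Hom[OF Ghat_nat, of "(Y, X)"] by simp
next
  fix f g assume "f \<in> Arr (rev_monoidal C)" "g \<in> Arr (rev_monoidal C)"
  then show "G $\<^sub>a (G $\<^sub>a f \<boxtimes>\<^bsub>rev_monoidal C\<^esub> g) \<cdot>\<^bsub>rev_monoidal C\<^esub> Ghat G (Dom (rev_monoidal C) g) (Dom (rev_monoidal C) f)
      = Ghat G (Cod (rev_monoidal C) g) (Cod (rev_monoidal C) f) \<cdot>\<^bsub>rev_monoidal C\<^esub> (G $\<^sub>a f \<boxtimes>\<^bsub>rev_monoidal C\<^esub> G $\<^sub>a g)"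
    using nat_trans.naturality[OF Ghat_nat, of "(g, f)" "(Dom C g, Dom C f)" "(Cod C g, Cod C f)"]
    by (simp add: Hom_def)
next
  fix X assume "X \<in> Obj (rev_monoidal C)"
  then show "counit G X \<in> Hom (rev_monoidal C) (G $\<^sub>o X) X"
    using nat_trans.component_Hom[OF counit_nat, of X] by simp
next
  fix f assume "f \<in> Arr (rev_monoidal C)"
  then show "f \<cdot>\<^bsub>rev_monoidal C\<^esub> counit G (Dom (rev_monoidal C) f)
      = counit G (Cod (rev_monoidal C) f) \<cdot>\<^bsub>rev_monoidal C\<^esub> G $\<^sub>a f"
    using nat_trans.naturality[OF counit_nat, of f "Dom C f" "Cod C f"] by (simp add: Hom_def)
qed

text \<open>
  The axioms of a comodule fall into three parts: one coaction in the given monoidal category, one in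
  its reverse, and the condition that relates the two.
\<close>

abbreviation check_coaction where
  "check_coaction \<equiv> right_coaction C G (Gcheck G) (counit G)"

abbreviation hat_coaction where
  "hat_coaction \<equiv> right_coaction (rev_monoidal C) G (\<lambda>X Y. Ghat G Y X) (counit G)"

definition compatible :: "'a \<Rightarrow> ('a \<Rightarrow> 'b) \<Rightarrow> ('a \<Rightarrow> 'b) \<Rightarrow> bool" where
  "compatible V v u \<longleftrightarrow> (\<forall>X \<in> Obj C. \<forall>Y \<in> Obj C.
     G2 C G X (V \<otimes> Y) \<cdot> (\<one> (G $\<^sub>o X) \<boxtimes> v Y) \<cdot> \<alpha> (G $\<^sub>o X) V (G $\<^sub>o Y)
       = G $\<^sub>a (\<alpha> X V Y) \<cdot> G2 C G (X \<otimes> V) Y \<cdot> (u X \<boxtimes> \<one> (G $\<^sub>o Y)))"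

interpretation check: right_multiplication C G "Gcheck G" "counit G"
  by (rule right_multiplication_Gcheck)

text \<open>
  The two formulations differ in the position of an associator, which is invertible, and in whether
  naturality is spelled out.
\<close>

lemma check_coaction_iff:
  "check_coaction V v \<longleftrightarrow> V \<in> Obj C \<and>
    nat_trans C C
      \<lparr>OMap = (\<lambda>X. V \<otimes> G $\<^sub>o X), AMap = (\<lambda>f. \<one> V \<boxtimes> G $\<^sub>a f)\<rparr>
      \<lparr>OMap = (\<lambda>X. G $\<^sub>o (V \<otimes> X)), AMap = (\<lambda>f. G $\<^sub>a (\<one> V \<boxtimes> f))\<rparr> v \<and>
    (\<forall>X \<in> Obj C. \<forall>Y \<in> Obj C.
      G $\<^sub>a (v X \<boxtimes> \<one> Y) \<cdot> G $\<^sub>a (\<a> V (G $\<^sub>o X) Y) \<cdot> v (G $\<^sub>o X \<otimes> Y)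
          \<cdot> (\<one> V \<boxtimes> Gcheck G X Y) \<cdot> \<alpha> V (G $\<^sub>o X) (G $\<^sub>o Y)
        = Gcheck G (V \<otimes> X) Y \<cdot> (v X \<boxtimes> \<one> (G $\<^sub>o Y))) \<and>
    (\<forall>X \<in> Obj C. counit G (V \<otimes> X) \<cdot> v X = \<one> V \<boxtimes> counit G X)"
  (is "_ \<longleftrightarrow> _ \<and> nat_trans C C ?F ?H v \<and> ?c \<and> ?e")
proof (cases "V \<in> Obj C")
  case V [simp]: True
  let ?nat = "(\<forall>X \<in> Obj C. v X \<in> Hom C (V \<otimes> G $\<^sub>o X) (G $\<^sub>o (V \<otimes> X))) \<and>
    (\<forall>f \<in> Arr C. G $\<^sub>a (\<one> V \<boxtimes> f) \<cdot> v (Dom C f) = v (Cod C f) \<cdot> (\<one> V \<boxtimes> G $\<^sub>a f))"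
  let ?c' = "\<forall>X \<in> Obj C. \<forall>Y \<in> Obj C.
      G $\<^sub>a (v X \<boxtimes> \<one> Y) \<cdot> G $\<^sub>a (\<a> V (G $\<^sub>o X) Y) \<cdot> v (G $\<^sub>o X \<otimes> Y) \<cdot> (\<one> V \<boxtimes> Gcheck G X Y)
        = Gcheck G (V \<otimes> X) Y \<cdot> (v X \<boxtimes> \<one> (G $\<^sub>o Y)) \<cdot> \<a> V (G $\<^sub>o X) (G $\<^sub>o Y)"
  have "is_functor C C ?F" "is_functor C C ?H"
    by (rule is_functorI; simp add: category_axioms Hom_def)+
  then have nat: "nat_trans C C ?F ?H v \<longleftrightarrow> ?nat"
    by (subst nat_trans_iff) simp_all
  have "?c \<longleftrightarrow> ?c'" if ?nat
  proof (intro ball_cong refl)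
    fix X Y assume X [simp]: "X \<in> Obj C" and Y [simp]: "Y \<in> Obj C"
    have v [simp]: "v Z \<in> Arr C" "Dom C (v Z) = V \<otimes> G $\<^sub>o Z" "Cod C (v Z) = G $\<^sub>o (V \<otimes> Z)"
      if "Z \<in> Obj C" for Z
      using \<open>?nat\<close> that by (auto simp: Hom_def)
    let ?l = "G $\<^sub>a (v X \<boxtimes> \<one> Y) \<cdot> G $\<^sub>a (\<a> V (G $\<^sub>o X) Y) \<cdot> v (G $\<^sub>o X \<otimes> Y) \<cdot> (\<one> V \<boxtimes> Gcheck G X Y)"
      and ?r = "Gcheck G (V \<otimes> X) Y \<cdot> (v X \<boxtimes> \<one> (G $\<^sub>o Y))" and ?a = "\<alpha> V (G $\<^sub>o X) (G $\<^sub>o Y)"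
    have "?l \<cdot> ?a = ?r \<longleftrightarrow> ?l = ?r \<cdot> inverse_of C ?a"
    proof
      assume "?l \<cdot> ?a = ?r"
      then have "?r \<cdot> inverse_of C ?a = (?l \<cdot> ?a) \<cdot> inverse_of C ?a" by simp
      then show "?l = ?r \<cdot> inverse_of C ?a" by simp
    next
      assume "?l = ?r \<cdot> inverse_of C ?a"
      then have "?l \<cdot> ?a = (?r \<cdot> inverse_of C ?a) \<cdot> ?a" by (rule arg_cong)
      then show "?l \<cdot> ?a = ?r" by simp
    qed
    then show "(G $\<^sub>a (v X \<boxtimes> \<one> Y) \<cdot> G $\<^sub>a (\<a> V (G $\<^sub>o X) Y) \<cdot> v (G $\<^sub>o X \<otimes> Y) \<cdot> (\<one> V \<boxtimes> Gcheck G X Y) \<cdot> ?a = ?r)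
      = (?l = Gcheck G (V \<otimes> X) Y \<cdot> (v X \<boxtimes> \<one> (G $\<^sub>o Y)) \<cdot> inverse_of C ?a)"
      by simp
  qed
  with nat show ?thesis
    using check.right_multiplication_axioms
    unfolding right_coaction_def right_coaction_axioms_def by (auto simp del: AMap_comp)
qed (auto simp: right_coaction_def right_coaction_axioms_def)

lemma hat_coaction_iff:
  "hat_coaction V v \<longleftrightarrow> V \<in> Obj C \<and>
    nat_trans C C
      \<lparr>OMap = (\<lambda>X. G $\<^sub>o X \<otimes> V), AMap = (\<lambda>f. G $\<^sub>a f \<boxtimes> \<one> V)\<rparr>
      \<lparr>OMap = (\<lambda>X. G $\<^sub>o (X \<otimes> V)), AMap = (\<lambda>f. G $\<^sub>a (f \<boxtimes> \<one> V))\<rparr> v \<and>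
    (\<forall>X \<in> Obj C. \<forall>Y \<in> Obj C.
      G $\<^sub>a (\<one> X \<boxtimes> v Y) \<cdot> G $\<^sub>a (\<alpha> X (G $\<^sub>o Y) V) \<cdot> v (X \<otimes> G $\<^sub>o Y) \<cdot> (Ghat G X Y \<boxtimes> \<one> V)
        = Ghat G X (Y \<otimes> V) \<cdot> (\<one> (G $\<^sub>o X) \<boxtimes> v Y) \<cdot> \<alpha> (G $\<^sub>o X) (G $\<^sub>o Y) V) \<and>
    (\<forall>X \<in> Obj C. counit G (X \<otimes> V) \<cdot> v X = counit G X \<boxtimes> \<one> V)"
  (is "_ \<longleftrightarrow> _ \<and> nat_trans C C ?F ?H v \<and> _")
proof (cases "V \<in> Obj C")
  case V [simp]: True
  have "is_functor C C ?F" "is_functor C C ?H"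
    by (rule is_functorI; simp add: category_axioms Hom_def)+
  then have nat: "nat_trans C C ?F ?H v \<longleftrightarrow>
      (\<forall>X \<in> Obj C. v X \<in> Hom C (G $\<^sub>o X \<otimes> V) (G $\<^sub>o (X \<otimes> V))) \<and>
      (\<forall>f \<in> Arr C. G $\<^sub>a (f \<boxtimes> \<one> V) \<cdot> v (Dom C f) = v (Cod C f) \<cdot> (G $\<^sub>a f \<boxtimes> \<one> V))"
    by (subst nat_trans_iff) simp_all
  then show ?thesis
    using right_multiplication_Ghat
    unfolding right_coaction_def right_coaction_axioms_def by auto
qed (auto simp: right_coaction_def right_coaction_axioms_def)

lemma comodule_iff:
  "comodule C G V \<longleftrightarrow> vcheck V \<in> extensional (Obj C) \<and> vhat V \<in> extensional (Obj C) \<and>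
    check_coaction (carr V) (vcheck V) \<and> hat_coaction (carr V) (vhat V) \<and>
    compatible (carr V) (vcheck V) (vhat V)"
  using multiplier_bicomonad_axioms
  unfolding comodule_def comodule_axioms_def check_coaction_iff hat_coaction_iff compatible_def
  by auto

lemma comodule_morphism_iff:
  "comodule_morphism C G V W f \<longleftrightarrow> comodule C G V \<and> comodule C G W \<and>
    coaction_hom C G (carr V) (vcheck V) (carr W) (vcheck W) f \<and>
    coaction_hom (rev_monoidal C) G (carr V) (vhat V) (carr W) (vhat W) f"
  unfolding comodule_morphism_def comodule_morphism_axioms_def coaction_hom_def by auto

lemma G2_simps [simp]:
  assumes "X \<in> Obj C" "Y \<in> Obj C"
  shows "G2 C G X Y \<in> Arr C" "Dom C (G2 C G X Y) = G $\<^sub>o X \<otimes> G $\<^sub>o Y" "Cod C (G2 C G X Y) = G $\<^sub>o (X \<otimes> Y)"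
  using assms by (simp_all add: G2_def)

lemma G2_natural:
  assumes f [simp]: "f \<in> Arr C" "Dom C f = X" "Cod C f = X'" and g [simp]: "g \<in> Arr C" "Dom C g = Y" "Cod C g = Y'"
  shows "G2 C G X' Y' \<cdot> (G $\<^sub>a f \<boxtimes> G $\<^sub>a g) = G $\<^sub>a (f \<boxtimes> g) \<cdot> G2 C G X Y"
proof -
  have [simp]: "X \<in> Obj C" "X' \<in> Obj C" "Y \<in> Obj C" "Y' \<in> Obj C"
    using f g Dom_Obj Cod_Obj by blast+
  have 1: "G $\<^sub>a (counit G X' \<boxtimes> \<one> Y') \<cdot> G $\<^sub>a (G $\<^sub>a f \<boxtimes> g) = G $\<^sub>a (f \<boxtimes> g) \<cdot> G $\<^sub>a (counit G X \<boxtimes> \<one> Y)"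
    by (simp flip: AMap_comp add: interchange check.e_natural)
  have 2: "Gcheck G X' Y' \<cdot> (G $\<^sub>a f \<boxtimes> G $\<^sub>a g) = G $\<^sub>a (G $\<^sub>a f \<boxtimes> g) \<cdot> Gcheck G X Y"
    using check.c_natural[of f g X Y] by simp
  show ?thesis
    by (simp add: G2_def 2 reassoc2[OF 1])
qed

lemma hat_coaction_simps:
  assumes "hat_coaction V u" "X \<in> Obj C"
  shows "u X \<in> Arr C" "Dom C (u X) = G $\<^sub>o X \<otimes> V" "Cod C (u X) = G $\<^sub>o (X \<otimes> V)"
  using right_coaction.v_simps[OF assms(1)] assms(2) by auto

lemma compatibleD:
  assumes "compatible V v u" "check_coaction V v" "hat_coaction V u"
    and X [simp]: "X \<in> Obj C" and Y [simp]: "Y \<in> Obj C"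
  shows "G2 C G X (V \<otimes> Y) \<cdot> (\<one> (G $\<^sub>o X) \<boxtimes> v Y)
    = G $\<^sub>a (\<alpha> X V Y) \<cdot> G2 C G (X \<otimes> V) Y \<cdot> (u X \<boxtimes> \<one> (G $\<^sub>o Y)) \<cdot> \<a> (G $\<^sub>o X) V (G $\<^sub>o Y)"
proof (rule iso_right_cancel[of "\<alpha> (G $\<^sub>o X) V (G $\<^sub>o Y)"])
  interpret V: right_coaction C G "Gcheck G" "counit G" V v by fact
  note [simp] = hat_coaction_simps[OF assms(3)]
  show "(G2 C G X (V \<otimes> Y) \<cdot> (\<one> (G $\<^sub>o X) \<boxtimes> v Y)) \<cdot> \<alpha> (G $\<^sub>o X) V (G $\<^sub>o Y)
    = (G $\<^sub>a (\<alpha> X V Y) \<cdot> G2 C G (X \<otimes> V) Y \<cdot> (u X \<boxtimes> \<one> (G $\<^sub>o Y)) \<cdot> \<a> (G $\<^sub>o X) V (G $\<^sub>o Y)) \<cdot> \<alpha> (G $\<^sub>o X) V (G $\<^sub>o Y)"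
    using assms(1) by (simp add: compatible_def)
  show "iso C (\<alpha> (G $\<^sub>o X) V (G $\<^sub>o Y))" by simp
qed (use right_coaction.v_simps[OF assms(2)] right_coaction.V_Obj[OF assms(2)]
  hat_coaction_simps[OF assms(3)] in auto)

text \<open>
  Compatibility exchanges a \<open>v\<close> in the right argument of \<open>G2\<close> for the other coaction of \<open>V\<close> in its left
  argument. The coaction of \<open>V \<otimes> W\<close> applies \<open>v\<close> last, next to \<open>G2\<close>; so \<open>V\<close> is exchanged first, after
  which \<open>w\<close> becomes adjacent to \<open>G2\<close> and is exchanged in turn. On the left this leaves the coaction of \<open>V\<close>
  applied before that of \<open>W\<close>, which is the order in the reversed category.
\<close>

lemma compatible_tensor:
  assumes "check_coaction V v" "hat_coaction V v'" "check_coaction W w" "hat_coaction W w'"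
    and V: "compatible V v v'" and W: "compatible W w w'"
  shows "compatible (V \<otimes> W) (tensor_coaction C G V v W w)
    (tensor_coaction (rev_monoidal C) G W w' V v')"
  unfolding compatible_def
proof (intro ballI)
  fix X Y assume X [simp]: "X \<in> Obj C" and Y [simp]: "Y \<in> Obj C"
  interpret V: right_coaction C G "Gcheck G" "counit G" V v by fact
  interpret W: right_coaction C G "Gcheck G" "counit G" W w by fact
  note [simp] = hat_coaction_simps[OF assms(2)] hat_coaction_simps[OF assms(4)]
  let ?GX = "G $\<^sub>o X" and ?GY = "G $\<^sub>o Y"
  note cV = compatibleD[OF V assms(1,2) X, of "W \<otimes> Y"]
    and cW = compatibleD[OF W assms(3,4), of "X \<otimes> V", OF _ Y]
  have n: "G2 C G X ((V \<otimes> W) \<otimes> Y) \<cdot> (\<one> ?GX \<boxtimes> G $\<^sub>a (\<a> V W Y))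
      = G $\<^sub>a (\<one> X \<boxtimes> \<a> V W Y) \<cdot> G2 C G X (V \<otimes> W \<otimes> Y)"
    using G2_natural[of "\<one> X" X X "\<a> V W Y"] by simp
  have n': "G2 C G (X \<otimes> V \<otimes> W) Y \<cdot> (G $\<^sub>a (\<alpha> X V W) \<boxtimes> \<one> ?GY)
      = G $\<^sub>a (\<alpha> X V W \<boxtimes> \<one> Y) \<cdot> G2 C G ((X \<otimes> V) \<otimes> W) Y"
    using G2_natural[of "\<alpha> X V W" "(X \<otimes> V) \<otimes> W" "X \<otimes> V \<otimes> W" "\<one> Y" Y Y] by simp
  have p: "\<a> (?GX \<otimes> V) W ?GY \<cdot> \<a> ?GX V (W \<otimes> ?GY) \<cdot> (\<one> ?GX \<boxtimes> \<alpha> V W ?GY) \<cdot> \<alpha> ?GX (V \<otimes> W) ?GY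
      = \<a> ?GX V W \<boxtimes> \<one> ?GY"
    by (simp add: reassoc2[OF pentagon_inv[symmetric]])
  have q: "G $\<^sub>a (\<one> X \<boxtimes> \<a> V W Y) \<cdot> G $\<^sub>a (\<alpha> X V (W \<otimes> Y)) \<cdot> G $\<^sub>a (\<alpha> (X \<otimes> V) W Y)
      = G $\<^sub>a (\<alpha> X (V \<otimes> W) Y) \<cdot> G $\<^sub>a (\<alpha> X V W \<boxtimes> \<one> Y)"
    using pentagon[of X V W Y, symmetric] by (simp flip: AMap_comp)
  have s: "(v' X \<boxtimes> \<one> (G $\<^sub>o (W \<otimes> Y))) \<cdot> (\<one> (?GX \<otimes> V) \<boxtimes> w Y) = (\<one> (G $\<^sub>o (X \<otimes> V)) \<boxtimes> w Y) \<cdot> (v' X \<boxtimes> \<one> (W \<otimes> ?GY))"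
    by (simp add: interchange)
  have a: "\<a> ?GX V (G $\<^sub>o (W \<otimes> Y)) \<cdot> (\<one> ?GX \<boxtimes> \<one> V \<boxtimes> w Y) = (\<one> (?GX \<otimes> V) \<boxtimes> w Y) \<cdot> \<a> ?GX V (W \<otimes> ?GY)"
    by (simp add: Assoc_inv_natural)
  have "G2 C G X ((V \<otimes> W) \<otimes> Y) \<cdot> (\<one> ?GX \<boxtimes> tensor_coaction C G V v W w Y) \<cdot> \<alpha> ?GX (V \<otimes> W) ?GY
    = G $\<^sub>a (\<one> X \<boxtimes> \<a> V W Y) \<cdot> G $\<^sub>a (\<alpha> X V (W \<otimes> Y)) \<cdot> G2 C G (X \<otimes> V) (W \<otimes> Y)
      \<cdot> (\<one> (G $\<^sub>o (X \<otimes> V)) \<boxtimes> w Y) \<cdot> (v' X \<boxtimes> \<one> (W \<otimes> ?GY)) \<cdot> \<a> ?GX V (W \<otimes> ?GY)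
      \<cdot> (\<one> ?GX \<boxtimes> \<alpha> V W ?GY) \<cdot> \<alpha> ?GX (V \<otimes> W) ?GY"
    by (simp add: tensor_coaction_def reassoc2[OF n] reassoc2[OF cV] reassoc2[OF a] reassoc2[OF s])
  also have "\<dots> = G $\<^sub>a (\<alpha> X (V \<otimes> W) Y) \<cdot> G $\<^sub>a (\<alpha> X V W \<boxtimes> \<one> Y) \<cdot> G2 C G ((X \<otimes> V) \<otimes> W) Y
      \<cdot> (w' (X \<otimes> V) \<boxtimes> \<one> ?GY) \<cdot> ((v' X \<boxtimes> \<one> W) \<boxtimes> \<one> ?GY) \<cdot> (\<a> ?GX V W \<boxtimes> \<one> ?GY)"
    by (simp add: reassoc2[OF cW] reassoc3[OF q] reassoc2[OF Assoc_inv_natural1] p)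
  also have "\<dots> = G $\<^sub>a (\<alpha> X (V \<otimes> W) Y) \<cdot> G2 C G (X \<otimes> V \<otimes> W) Y
      \<cdot> (tensor_coaction (rev_monoidal C) G W w' V v' X \<boxtimes> \<one> ?GY)"
    by (simp add: tensor_coaction_def reassoc2[OF n'])
  finally show "G2 C G X ((V \<otimes> W) \<otimes> Y) \<cdot> (\<one> ?GX \<boxtimes> tensor_coaction C G V v W w Y) \<cdot> \<alpha> ?GX (V \<otimes> W) ?GY
    = G $\<^sub>a (\<alpha> X (V \<otimes> W) Y) \<cdot> G2 C G (X \<otimes> V \<otimes> W) Y
      \<cdot> (tensor_coaction (rev_monoidal C) G W w' V v' X \<boxtimes> \<one> ?GY)" .
qed

text \<open>
  By naturality of \<open>G2\<close> and the triangle identity, the unit object between \<open>X\<close> and \<open>Y\<close> can be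
  absorbed into either of them.
\<close>

lemma compatible_unit:
  "compatible (Unit C) (unit_coaction C G) (unit_coaction (rev_monoidal C) G)"
  unfolding compatible_def
proof (intro ballI)
  fix X Y assume X [simp]: "X \<in> Obj C" and Y [simp]: "Y \<in> Obj C"
  have n: "G2 C G X (Unit C \<otimes> Y) \<cdot> (\<one> (G $\<^sub>o X) \<boxtimes> G $\<^sub>a (inverse_of C (LUnit C Y)))
      = G $\<^sub>a (\<one> X \<boxtimes> inverse_of C (LUnit C Y)) \<cdot> G2 C G X Y"
    using G2_natural[of "\<one> X" X X "inverse_of C (LUnit C Y)"] by simp
  have n': "G2 C G (X \<otimes> Unit C) Y \<cdot> (G $\<^sub>a (inverse_of C (RUnit C X)) \<boxtimes> \<one> (G $\<^sub>o Y))
      = G $\<^sub>a (inverse_of C (RUnit C X) \<boxtimes> \<one> Y) \<cdot> G2 C G X Y"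
    using G2_natural[of "inverse_of C (RUnit C X)" X "X \<otimes> Unit C" "\<one> Y" Y Y] by simp
  have t: "\<alpha> X (Unit C) Y \<cdot> (inverse_of C (RUnit C X) \<boxtimes> \<one> Y) = \<one> X \<boxtimes> inverse_of C (LUnit C Y)"
  proof (rule iso_left_cancel[of "\<one> X \<boxtimes> LUnit C Y"])
    show "(\<one> X \<boxtimes> LUnit C Y) \<cdot> \<alpha> X (Unit C) Y \<cdot> (inverse_of C (RUnit C X) \<boxtimes> \<one> Y)
      = (\<one> X \<boxtimes> LUnit C Y) \<cdot> (\<one> X \<boxtimes> inverse_of C (LUnit C Y))"
      by (simp add: reassoc2[OF triangle])
  qed auto
  have t': "G $\<^sub>a (\<alpha> X (Unit C) Y) \<cdot> G $\<^sub>a (inverse_of C (RUnit C X) \<boxtimes> \<one> Y) = G $\<^sub>a (\<one> X \<boxtimes> inverse_of C (LUnit C Y))"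
    by (simp flip: AMap_comp t)
  show "G2 C G X (Unit C \<otimes> Y) \<cdot> (\<one> (G $\<^sub>o X) \<boxtimes> unit_coaction C G Y) \<cdot> \<alpha> (G $\<^sub>o X) (Unit C) (G $\<^sub>o Y)
      = G $\<^sub>a (\<alpha> X (Unit C) Y) \<cdot> G2 C G (X \<otimes> Unit C) Y \<cdot> (unit_coaction (rev_monoidal C) G X \<boxtimes> \<one> (G $\<^sub>o Y))"
    by (simp add: unit_coaction_def reassoc2[OF n] reassoc2[OF n'] reassoc2[OF t'] triangle)
qed

end

section \<open>The tensor product of comodules\<close>

text \<open>
  The coactions of a comodule are extensional, so the formulas for tensor products are restricted to
  objects. A coaction is only ever evaluated at objects, and the restrictions can be
  removed.
\<close>

lemma tensor_coaction_restrict [simp]: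
  "W \<otimes>\<^bsub>C\<^esub> X \<in> A \<Longrightarrow> tensor_coaction C G V (restrict v A) W w X = tensor_coaction C G V v W w X"
  "X \<in> A \<Longrightarrow> tensor_coaction C G V v W (restrict w A) X = tensor_coaction C G V v W w X"
  by (simp_all add: tensor_coaction_def)

lemma (in right_multiplication) right_coaction_restrict:
  assumes "right_coaction C G c e V v"
  shows "right_coaction C G c e V (restrict v (Obj C))"
proof -
  interpret right_coaction C G c e V v by fact
  show ?thesis
    by unfold_locales (simp_all add: v_Hom v_natural' v_c e_v)
qed

text \<open>
  The component \<open>vhat\<close> is the tensor product of coactions in the reversed category, whose first
  factor is \<open>W\<close>.
\<close>

definition tensor_comodule ::
  "('o, 'm, 'z) monoidal_category_scheme \<Rightarrow> ('o, 'm, 'y) bicomonad_scheme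
    \<Rightarrow> ('o, 'm) comodule \<Rightarrow> ('o, 'm) comodule \<Rightarrow> ('o, 'm) comodule" where
  "tensor_comodule C G V W = \<lparr>
     carr = carr V \<otimes>\<^bsub>C\<^esub> carr W,
     vcheck = restrict (tensor_coaction C G (carr V) (vcheck V) (carr W) (vcheck W)) (Obj C),
     vhat = restrict (tensor_coaction (rev_monoidal C) G (carr W) (vhat W) (carr V) (vhat V)) (Obj C)\<rparr>"

definition unit_comodule ::
  "('o, 'm, 'z) monoidal_category_scheme \<Rightarrow> ('o, 'm, 'y) bicomonad_scheme \<Rightarrow> ('o, 'm) comodule" where
  "unit_comodule C G = \<lparr>
     carr = Unit C,
     vcheck = restrict (unit_coaction C G) (Obj C),
     vhat = restrict (unit_coaction (rev_monoidal C) G) (Obj C)\<rparr>"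

lemma carr_simps [simp]:
  "carr (tensor_comodule C G V W) = carr V \<otimes>\<^bsub>C\<^esub> carr W" "carr (unit_comodule C G) = Unit C"
  by (simp_all add: tensor_comodule_def unit_comodule_def)

context multiplier_bicomonad
begin

lemma comodule_tensor:
  assumes "comodule C G V" "comodule C G W"
  shows "comodule C G (tensor_comodule C G V W)"
proof -
  note h = assms[unfolded comodule_iff]
  have "check_coaction (carr V \<otimes> carr W) (restrict (tensor_coaction C G (carr V) (vcheck V) (carr W) (vcheck W)) (Obj C))"
    using h by (intro right_multiplication.right_coaction_restrict right_multiplication_Gcheck
      right_multiplication.right_coaction_tensor) auto
  moreover have "hat_coaction (carr V \<otimes> carr W)
      (restrict (tensor_coaction (rev_monoidal C) G (carr W) (vhat W) (carr V) (vhat V)) (Obj C))"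
    using h right_multiplication.right_coaction_restrict[OF right_multiplication_Ghat
      right_multiplication.right_coaction_tensor[OF right_multiplication_Ghat, of "carr W" "vhat W" "carr V" "vhat V"]]
    by simp
  moreover have "compatible (carr V \<otimes> carr W) (tensor_coaction C G (carr V) (vcheck V) (carr W) (vcheck W))
      (tensor_coaction (rev_monoidal C) G (carr W) (vhat W) (carr V) (vhat V))"
    using h by (intro compatible_tensor) auto
  ultimately show ?thesis
    by (simp add: comodule_iff tensor_comodule_def compatible_def)
qed

lemma comodule_unit: "comodule C G (unit_comodule C G)"
proof -
  have "hat_coaction (Unit C) (restrict (unit_coaction (rev_monoidal C) G) (Obj C))"
    using right_multiplication.right_coaction_restrict[OF right_multiplication_Ghat
      right_multiplication.right_coaction_unit[OF right_multiplication_Ghat]] by simp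
  moreover have "check_coaction (Unit C) (restrict (unit_coaction C G) (Obj C))"
    by (intro right_multiplication.right_coaction_restrict right_multiplication.right_coaction_unit
      right_multiplication_Gcheck)
  ultimately show ?thesis
    using compatible_unit by (simp add: comodule_iff unit_comodule_def compatible_def)
qed

lemma comodule_carr_Obj [simp]: "comodule C G V \<Longrightarrow> carr V \<in> Obj C"
  by (rule comodule.carr_Obj)

lemma comodule_morphismD:
  assumes "comodule_morphism C G V W f"
  shows "f \<in> Arr C" "Dom C f = carr V" "Cod C f = carr W" "comodule C G V" "comodule C G W"
  using assms by (auto simp: comodule_morphism_iff coaction_hom_def Hom_def)

lemma comodule_morphism_arrow:
  "comodule_morphism C G V W f \<Longrightarrow> f \<in> Arr C \<and> Dom C f = carr V \<and> Cod C f = carr W"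
  by (simp add: comodule_morphismD)

lemma comodule_morphism_Idt:
  assumes "comodule C G V"
  shows "comodule_morphism C G V V (\<one> (carr V))"
  using assms right_multiplication.coaction_hom_Idt[OF right_multiplication_Gcheck, of "carr V" "vcheck V"]
    right_multiplication.coaction_hom_Idt[OF right_multiplication_Ghat, of "carr V" "vhat V"]
  by (simp add: comodule_morphism_iff comodule_iff)

lemma comodule_morphism_Comp:
  assumes "comodule_morphism C G U V f" "comodule_morphism C G V W g"
  shows "comodule_morphism C G U W (g \<cdot> f)"
  using assms
    right_multiplication.coaction_hom_Comp[OF right_multiplication_Gcheck,
      of "carr U" "vcheck U" "carr V" "vcheck V" f "carr W" "vcheck W" g]
    right_multiplication.coaction_hom_Comp[OF right_multiplication_Ghat,
      of "carr U" "vhat U" "carr V" "vhat V" f "carr W" "vhat W" g]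
  by (simp add: comodule_morphism_iff comodule_iff)

lemma comodule_morphism_inverse:
  assumes "comodule_morphism C G V W f" "iso C f"
  shows "comodule_morphism C G W V (inverse_of C f)"
  using assms
    right_multiplication.coaction_hom_inverse[OF right_multiplication_Gcheck,
      of "carr V" "vcheck V" "carr W" "vcheck W" f]
    right_multiplication.coaction_hom_inverse[OF right_multiplication_Ghat,
      of "carr V" "vhat V" "carr W" "vhat W" f]
  by (simp add: comodule_morphism_iff comodule_iff)

lemma comodule_morphism_tensor:
  assumes "comodule_morphism C G V V' f" "comodule_morphism C G W W' g"
  shows "comodule_morphism C G (tensor_comodule C G V W) (tensor_comodule C G V' W') (f \<boxtimes> g)"
  using assms
    right_multiplication.coaction_hom_tensor[OF right_multiplication_Gcheck,
      of "carr V" "vcheck V" "carr V'" "vcheck V'" f "carr W" "vcheck W" "carr W'" "vcheck W'" g]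
    right_multiplication.coaction_hom_tensor[OF right_multiplication_Ghat,
      of "carr W" "vhat W" "carr W'" "vhat W'" g "carr V" "vhat V" "carr V'" "vhat V'" f]
    comodule_tensor[of V W] comodule_tensor[of V' W']
  unfolding comodule_morphism_iff
  by (simp add: comodule_iff[of V] comodule_iff[of V'] comodule_iff[of W] comodule_iff[of W']
      tensor_comodule_def coaction_hom_def)

lemma comodule_morphism_LUnit:
  assumes V: "comodule C G V"
  shows "comodule_morphism C G (tensor_comodule C G (unit_comodule C G) V) V (LUnit C (carr V))"
  using V comodule_tensor[OF comodule_unit V]
    right_multiplication.coaction_hom_LUnit[OF right_multiplication_Gcheck, of "carr V" "vcheck V"]
    right_multiplication.coaction_hom_RUnit[OF right_multiplication_Ghat, of "carr V" "vhat V"]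
  unfolding comodule_morphism_iff
  by (simp add: comodule_iff[of V] tensor_comodule_def unit_comodule_def coaction_hom_def)

lemma comodule_morphism_RUnit:
  assumes V: "comodule C G V"
  shows "comodule_morphism C G (tensor_comodule C G V (unit_comodule C G)) V (RUnit C (carr V))"
  using V comodule_tensor[OF V comodule_unit]
    right_multiplication.coaction_hom_RUnit[OF right_multiplication_Gcheck, of "carr V" "vcheck V"]
    right_multiplication.coaction_hom_LUnit[OF right_multiplication_Ghat, of "carr V" "vhat V"]
  unfolding comodule_morphism_iff
  by (simp add: comodule_iff[of V] tensor_comodule_def unit_comodule_def coaction_hom_def)

lemma comodule_morphism_Assoc:
  assumes U: "comodule C G U" and V: "comodule C G V" and W: "comodule C G W"
  shows "comodule_morphism C G (tensor_comodule C G (tensor_comodule C G U V) W)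
    (tensor_comodule C G U (tensor_comodule C G V W)) (\<alpha> (carr U) (carr V) (carr W))"
proof -
  let ?a = "\<alpha> (carr U) (carr V) (carr W)"
  let ?s = "tensor_comodule C G (tensor_comodule C G U V) W"
    and ?t = "tensor_comodule C G U (tensor_comodule C G V W)"
  have st: "comodule C G ?s" "comodule C G ?t"
    using assms by (auto intro: comodule_tensor)
  have "coaction_hom C G (carr ?s) (vcheck ?s) (carr ?t) (vcheck ?t) ?a"
    using assms right_multiplication.coaction_hom_Assoc[OF right_multiplication_Gcheck,
      of "carr U" "vcheck U" "carr V" "vcheck V" "carr W" "vcheck W"]
    by (simp add: comodule_iff[of U] comodule_iff[of V] comodule_iff[of W]
      tensor_comodule_def coaction_hom_def)
  moreover
  \<comment> \<open>In the reversed category the associator runs in the opposite direction.\<close>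
  have "coaction_hom (rev_monoidal C) G (carr ?t) (vhat ?t) (carr ?s) (vhat ?s) (inverse_of C ?a)"
    using assms right_multiplication.coaction_hom_Assoc[OF right_multiplication_Ghat,
      of "carr W" "vhat W" "carr V" "vhat V" "carr U" "vhat U"]
    by (simp add: comodule_iff[of U] comodule_iff[of V] comodule_iff[of W]
      tensor_comodule_def coaction_hom_def)
  then have "coaction_hom (rev_monoidal C) G (carr ?s) (vhat ?s) (carr ?t) (vhat ?t) ?a"
    using right_multiplication.coaction_hom_inverse[OF right_multiplication_Ghat,
      of "carr ?t" "vhat ?t" "carr ?s" "vhat ?s" "inverse_of C ?a"] st assms
    by (simp add: comodule_iff[of ?s] comodule_iff[of ?t])
  ultimately show ?thesis
    using st by (simp add: comodule_morphism_iff)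
qed

end

section \<open>The monoidal category of comodules\<close>

definition comodule_monoidal ::
  "('o, 'm) monoidal_category \<Rightarrow> ('o, 'm) bicomonad
    \<Rightarrow> (('o, 'm) comodule, ('o, 'm) comodule \<times> 'm \<times> ('o, 'm) comodule) monoidal_category" where
  "comodule_monoidal C G = \<lparr>
     Obj = Obj (comodule_cat C G), Arr = Arr (comodule_cat C G),
     Dom = Dom (comodule_cat C G), Cod = Cod (comodule_cat C G),
     Idt = Idt (comodule_cat C G), Comp = Comp (comodule_cat C G),
     TOb = tensor_comodule C G,
     TAr = (\<lambda>(V, f, V') (W, g, W').
       (tensor_comodule C G V W, f \<boxtimes>\<^bsub>C\<^esub> g, tensor_comodule C G V' W')),
     Unit = unit_comodule C G,
     Assoc = (\<lambda>U V W. (tensor_comodule C G (tensor_comodule C G U V) W,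
       \<alpha>\<^bsub>C\<^esub> (carr U) (carr V) (carr W), tensor_comodule C G U (tensor_comodule C G V W))),
     LUnit = (\<lambda>V. (tensor_comodule C G (unit_comodule C G) V, LUnit C (carr V), V)),
     RUnit = (\<lambda>V. (tensor_comodule C G V (unit_comodule C G), RUnit C (carr V), V)) \<rparr>"

lemma comodule_monoidal_simps [simp]:
  "Obj (comodule_monoidal C G) = {V. comodule C G V}"
  "(V, f, W) \<in> Arr (comodule_monoidal C G) \<longleftrightarrow> comodule_morphism C G V W f"
  "Dom (comodule_monoidal C G) (V, f, W) = V"
  "Cod (comodule_monoidal C G) (V, f, W) = W"
  "Idt (comodule_monoidal C G) V = (V, \<one>\<^bsub>C\<^esub> (carr V), V)"
  "Comp (comodule_monoidal C G) (V', g, W) (U, f, V) = (U, g \<cdot>\<^bsub>C\<^esub> f, W)"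
  "TOb (comodule_monoidal C G) = tensor_comodule C G"
  "TAr (comodule_monoidal C G) (V, f, V') (W, g, W') =
    (tensor_comodule C G V W, f \<boxtimes>\<^bsub>C\<^esub> g, tensor_comodule C G V' W')"
  "Unit (comodule_monoidal C G) = unit_comodule C G"
  "Assoc (comodule_monoidal C G) U V W = (tensor_comodule C G (tensor_comodule C G U V) W,
     \<alpha>\<^bsub>C\<^esub> (carr U) (carr V) (carr W), tensor_comodule C G U (tensor_comodule C G V W))"
  "LUnit (comodule_monoidal C G) V = (tensor_comodule C G (unit_comodule C G) V, LUnit C (carr V), V)"
  "RUnit (comodule_monoidal C G) V = (tensor_comodule C G V (unit_comodule C G), RUnit C (carr V), V)"
  by (simp_all add: comodule_monoidal_def comodule_cat_def)

lemma comodule_monoidal_Hom: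
  "p \<in> Hom (comodule_monoidal C G) V W \<longleftrightarrow> (\<exists>f. p = (V, f, W) \<and> comodule_morphism C G V W f)"
  by (cases p) (auto simp: Hom_def)

lemma category_comodule_monoidal:
  assumes "multiplier_bicomonad C G"
  shows "category (comodule_monoidal C G)"
proof -
  interpret multiplier_bicomonad C G by fact
  show ?thesis
  proof
    fix p assume p: "p \<in> Arr (comodule_monoidal C G)"
    then show "Dom (comodule_monoidal C G) p \<in> Obj (comodule_monoidal C G)"
      and "Cod (comodule_monoidal C G) p \<in> Obj (comodule_monoidal C G)"
      by (cases p; auto dest: comodule_morphismD)+
  next
    fix p U V q W assume "p \<in> Hom (comodule_monoidal C G) U V" "q \<in> Hom (comodule_monoidal C G) V W"
    then show "q \<cdot>\<^bsub>comodule_monoidal C G\<^esub> p \<in> Hom (comodule_monoidal C G) U W"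
      by (auto simp: comodule_monoidal_Hom comodule_morphism_Comp)
  qed (auto simp: comodule_monoidal_Hom comodule_morphism_Idt dest!: comodule_morphism_arrow)
qed

text \<open>
  The forgetful functor reflects isomorphisms, because the inverse of an invertible comodule
  morphism is a comodule morphism.
\<close>

lemma iso_comodule_monoidal:
  assumes "multiplier_bicomonad C G" "comodule_morphism C G V W f" "iso C f"
  shows "iso (comodule_monoidal C G) (V, f, W)"
proof -
  interpret multiplier_bicomonad C G by fact
  have "is_inverse (comodule_monoidal C G) (V, f, W) (W, inverse_of C f, V)"
    using assms(2,3) comodule_morphism_inverse[of V W f] comodule_morphismD[OF assms(2)]
      is_inverse_inverse_of[OF assms(3)]
    by (simp add: is_inverse_def comodule_monoidal_Hom del: inverse_cancel)
  then show ?thesis by (auto simp: iso_def)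
qed

text \<open>
  Arrows between fixed comodules are equal when their underlying arrows are, so every equation
  between arrows is inherited from the base category.
\<close>

lemma monoidal_category_comodule_monoidal:
  assumes "multiplier_bicomonad C G"
  shows "monoidal_category (comodule_monoidal C G)"
proof -
  interpret multiplier_bicomonad C G by fact
  note [simp] = comodule_morphism_tensor comodule_morphism_Assoc comodule_morphism_LUnit
    comodule_morphism_RUnit comodule_tensor comodule_unit comodule_monoidal_Hom
    iso_comodule_monoidal[OF assms]
  show ?thesis
  proof (rule monoidal_categoryI)
    show "category (comodule_monoidal C G)" by (rule category_comodule_monoidal[OF assms])
  qed (auto dest: comodule_morphismD,
      auto simp: interchange Assoc_natural LUnit_natural RUnit_natural pentagon triangle
        dest!: comodule_morphism_arrow)
qed

theorem theorem4p5:
  fixes C :: "('o, 'm) monoidal_category" and G :: "('o, 'm) bicomonad"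
  assumes "monoidal_category C"
    and "multiplier_bicomonad C G"
  shows "\<exists>M :: (('o, 'm) comodule, ('o, 'm) comodule \<times> 'm \<times> ('o, 'm) comodule) monoidal_category.
    category.truncate M = comodule_cat C G
    \<and> monoidal_category M
    \<and> strict_monoidal_functor M C forgetful"
proof (intro exI conjI)
  interpret multiplier_bicomonad C G by fact
  let ?M = "comodule_monoidal C G"
  show "category.truncate ?M = comodule_cat C G"
    by (simp add: category.truncate_def comodule_monoidal_def comodule_cat_def)
  show M: "monoidal_category ?M"
    using assms(2) by (rule monoidal_category_comodule_monoidal)
  have "is_functor ?M C forgetful"
    using M assms(1)
    by (intro is_functorI)
      (auto simp: monoidal_category_def forgetful_def Hom_def dest: comodule_morphismD)
  then show "strict_monoidal_functor ?M C forgetful"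
    using M assms(1)
    by (auto simp: strict_monoidal_functor_def strict_monoidal_functor_axioms_def forgetful_def)
qed

end
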